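(* Let $N$ be a real skew-symmetric $n\times n$ matrix, let $k=\lfloor n/2\rfloor$, let $\mathcal{O}_N=\mathrm{conv}\{gNg^T: g\in O(n)\}$, and let $\Pi^s(\tilde\lambda(N))\subset\mathbb{R}^k$ be the $B_k$-permutahedron of $\tilde\lambda(N)$. Then for every nonempty face $F$ of $\mathcal{O}_N$, the $O(n)$-orbit $\{gFg^T:g\in O(n)\}$ contains the pullback $\mathsf{SD}^{-1}(P)\cap\mathcal{O}_N$ of a face $P$ of $\Pi^s(\tilde\lambda(N))$, and the $B_k$-orbit of such a face $P$ is unique.
   Context: $\wedge_2\mathbb{R}^n$ is identified with the space of real skew-symmetric $n\times n$ matrices, on which $O(n)$ acts by $g\cdot A=gAg^T$. The eigenvalues of $N$ are $\pm i\tilde\lambda_1,\dots,\pm i\tilde\lambda_k$ with $\tilde\lambda_1\ge\cdots\ge\tilde\lambda_k\ge0$, together with an additional $0$ if $n$ is odd; $\tilde\lambda(N)=(\tilde\lambda_1,\dots,\tilde\lambda_k)$. The $O(n)$-action brings $N$ to the normal form $\begin{pmatrix}0&\Lambda\\-\Lambda&0\end{pmatrix}$ if $n$ is even and $\begin{pmatrix}0&0&\Lambda\\0&0&0\\-\Lambda&0&0\end{pmatrix}$ (with middle block of size one) if $n$ is odd, where $\Lambda=\mathrm{diag}(\tilde\lambda_1,\dots,\tilde\lambda_k)$. The skew-diagonal $\mathsf{SD}:\wedge_2\mathbb{R}^n\to\mathbb{R}^k$ is the linear map that reads off the diagonal of the upper right $k\times k$ block: $\mathsf{SD}(A)=(A_{1,k+1},A_{2,k+2},\dots,A_{k,2k})$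 if $n=2k$, and $\mathsf{SD}(A)=(A_{1,k+2},A_{2,k+3},\dots,A_{k,2k+1})$ if $n=2k+1$. $B_k$ is the group of all $2^k k!$ signed permutations acting on $\mathbb{R}^k$, and for $p\in\mathbb{R}^k$ the $B_k$-permutahedron $\Pi^s(p)$ is the convex hull of the $B_k$-orbit of $p$; $\mathsf{SD}$ maps $\mathcal{O}_N$ onto $\Pi^s(\tilde\lambda(N))$. A face of a convex body $K$ is a closed convex subset $F\subseteq K$ that contains the two endpoints of every open segment in $K$ that it intersects. *)

theory Defs
  imports "HOL-Analysis.Analysis" "HOL-Combinatorics.Permutations"
begin

text \<open>
  Real \<open>n \<times> n\<close> matrices are elements of \<open>real^'n^'n\<close> with \<open>n = CARD('n)\<close>. The type \<open>'n\<close>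
  carries no order, so the positions \<open>1, \<dots>, n\<close> of rows and columns are given by an enumeration
  \<open>e\<close>, a bijection from \<open>{1..CARD('n)}\<close> onto \<open>UNIV\<close>.

  For \<open>n = 1\<close> we have \<open>k = n div 2 = 0\<close>, and there is no empty index type. We therefore realise
  \<open>\<real>\<^sup>k\<close> as the coordinate subspace of \<open>real^'n\<close> of vectors that vanish at all positions greater
  than \<open>k\<close>.
\<close>

definition half_dim :: "'n::finite itself \<Rightarrow> nat" where
  "half_dim _ = CARD('n) div 2"

text \<open>The vector \<open>(f 1, \<dots>, f k)\<close>.\<close>

definition tuple :: "(nat \<Rightarrow> 'n::finite) \<Rightarrow> (nat \<Rightarrow> real) \<Rightarrow> real^'n" where
  "tuple e f = (\<chi> i. let j = inv_into {1..CARD('n)} e i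
                      in if j \<le> half_dim TYPE('n) then f j else 0)"

definition skew_symmetric :: "real^'n^'n \<Rightarrow> bool" where
  "skew_symmetric A \<longleftrightarrow> transpose A = - A"

definition conj_act :: "real^'n^'n \<Rightarrow> real^'n^'n \<Rightarrow> real^'n^'n" where
  "conj_act g A = g ** A ** transpose g"

definition orbitope :: "real^'n^'n \<Rightarrow> (real^'n^'n) set" where
  "orbitope N = convex hull {conj_act g N | g. orthogonal_matrix g}"

definition complexify :: "real^'n^'n \<Rightarrow> complex^'n^'n" where
  "complexify A = (\<chi> i j. complex_of_real (A $ i $ j))"

text \<open>
  The eigenvalues of \<open>N\<close>, with multiplicity, are the roots of its characteristic polynomial
  \<open>z \<mapsto> det (z I - N)\<close>. For skew-symmetric \<open>N\<close> there is exactly one vector \<open>p\<close> as below; for other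
  \<open>N\<close> the value is unspecified.
\<close>

definition skew_eigenvalues :: "(nat \<Rightarrow> 'n::finite) \<Rightarrow> real^'n^'n \<Rightarrow> real^'n" where
  "skew_eigenvalues e N = (THE p. \<exists>l. p = tuple e l \<and>
     (\<forall>j\<in>{1..half_dim TYPE('n)}. 0 \<le> l j) \<and>
     (\<forall>j\<in>{1..half_dim TYPE('n)}. \<forall>j'\<in>{1..half_dim TYPE('n)}. j \<le> j' \<longrightarrow> l j' \<le> l j) \<and>
     (\<forall>z. det (mat z - complexify N) =
        z ^ (CARD('n) mod 2) *
        (\<Prod>j = 1..half_dim TYPE('n). (z - \<i> * complex_of_real (l j)) * (z + \<i> * complex_of_real (l j)))))"

text \<open>
  The upper right block has columns \<open>k + 1, \<dots>, 2 k\<close> if \<open>n = 2 k\<close>, and \<open>k + 2, \<dots>, 2 k + 1\<close> if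
  \<open>n = 2 k + 1\<close>; in both cases its \<open>j\<close>-th column is column \<open>n - k + j\<close>.
\<close>

definition SD :: "(nat \<Rightarrow> 'n::finite) \<Rightarrow> real^'n^'n \<Rightarrow> real^'n" where
  "SD e A = tuple e (\<lambda>j. A $ e j $ e (CARD('n) - half_dim TYPE('n) + j))"

definition signed_perms :: "(nat \<Rightarrow> 'n::finite) \<Rightarrow> (real^'n \<Rightarrow> real^'n) set" where
  "signed_perms e = {(\<lambda>x. tuple e (\<lambda>j. s j * x $ e (\<pi> j))) | \<pi> s.
     \<pi> permutes {1..half_dim TYPE('n)} \<and> (\<forall>j. s j \<in> {1, - 1})}"

definition B_permutahedron :: "(nat \<Rightarrow> 'n::finite) \<Rightarrow> real^'n \<Rightarrow> (real^'n) set" where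
  "B_permutahedron e p = convex hull {w p | w. w \<in> signed_perms e}"

definition closed_face :: "'a::real_normed_vector set \<Rightarrow> 'a set \<Rightarrow> bool" where
  "closed_face F K \<longleftrightarrow> closed F \<and> F face_of K"

definition O_orbit :: "(real^'n^'n) set \<Rightarrow> (real^'n^'n) set set" where
  "O_orbit F = {conj_act g ` F | g. orthogonal_matrix g}"

definition B_orbit :: "(nat \<Rightarrow> 'n::finite) \<Rightarrow> (real^'n) set \<Rightarrow> (real^'n) set set" where
  "B_orbit e P = {w ` P | w. w \<in> signed_perms e}"

end

theory Submission
  imports Defs
begin

text \<open>
  The skew-symmetric matrices form the Lie algebra of the orthogonal group, and the normal forms
  with entries \<open>x \<in> \<real>\<^sup>k\<close> form a maximal abelian subalgebra of it. Two facts about this situation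
  carry everything.

  \<^item> If a conjugate of \<open>A\<close> maximises the trace inner product with \<open>B\<close>, it commutes with \<open>B\<close>: the
    derivative along conjugation by \<open>exp (t X)\<close> is the inner product of \<open>X\<close> with the commutator
    \<open>[A, B]\<close>, and \<open>X = [A, B]\<close> is allowed. This remains true for conjugation only by those
    orthogonal matrices that commute with a given set \<open>C\<close>, if \<open>A\<close> and \<open>B\<close> commute with \<open>C\<close>
    (\<open>commute_at_maximum\<close>).
  \<^item> Consequently a skew-symmetric matrix that commutes with some normal forms can be brought to
    normal form by a conjugation that fixes all of them (\<open>simultaneous_normal_form\<close>): maximise the
    inner product with a normal form whose entries are distinct and positive. For the empty
    set this is the usual normal form.

  The skew-diagonal is, up to the factor \<open>2\<close>, the adjoint of \<open>x \<mapsto> normal_form x\<close>. Maximising a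
  linear functional given by a normal form therefore shows that the skew-diagonal maps the orbitope
  into the permutahedron (\<open>skew_diag_orbitope\<close>), so the preimage \<open>G\<close> in the orbitope of a face \<open>P\<close> of
  the permutahedron is a face of the orbitope.

  The main point is that a relative interior point \<open>a\<close> of \<open>P\<close> has its normal form in the relative
  interior of \<open>G\<close> (\<open>rel_interior_pullback\<close>). The polytope face \<open>P\<close> is exposed by some \<open>y\<close>; then
  all of \<open>G\<close> commutes with the normal form of \<open>y\<close>, and \<open>G\<close> is invariant under the stabiliser of that
  normal form. Suppose that some \<open>Z\<close> supports \<open>G\<close> properly at the normal form of \<open>a\<close>. It may be
  projected to the commutant of the normal form of \<open>y\<close>; by the first fact it then commutes with the
  normal form of \<open>a\<close>, and by the second it may be assumed to be a normal form itself. So it is a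
  linear functional on \<open>P\<close> that has its minimum at the relative interior point \<open>a\<close>. Such a functional
  is constant on \<open>P\<close>, hence \<open>Z\<close> is constant on \<open>G\<close>, a contradiction.

  Existence follows: conjugate a relative interior point of the face \<open>F\<close> to a normal form of some
  \<open>a\<close>, and let \<open>P\<close> be the face of the permutahedron with \<open>a\<close> in its relative interior. The conjugate
  of \<open>F\<close> and the pullback of \<open>P\<close> are faces whose relative interiors meet, so they are equal. For
  uniqueness, let \<open>g\<close> carry the pullback of \<open>P\<close> to that of \<open>Q\<close>. The image of the normal form of a
  relative interior point \<open>a\<close> of \<open>P\<close> can be conjugated, inside the stabiliser of the pullback of \<open>Q\<close>,
  to the normal form of some \<open>b\<close>, which lies in the relative interior of \<open>Q\<close>. Since \<open>a\<close> and \<open>b\<close> have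
  conjugate normal forms, the characteristic polynomial shows that they differ by a signed permutation
  \<open>w\<close>, and the faces \<open>w ` P\<close> and \<open>Q\<close> agree because their relative interiors meet.
\<close>

section \<open>Matrices with the trace inner product\<close>

lemma transpose_add: "transpose (A + B) = transpose A + transpose (B :: 'a::monoid_add^'n^'m)"
  and transpose_diff: "transpose (C - D) = transpose C - transpose (D :: 'b::group_add^'n^'m)"
  by (simp_all add: transpose_def vec_eq_iff)

lemma matrix_add_mult: "(A + B) ** C = A ** C + B ** (C :: 'a::semiring_1^'k^'n)"
  by (simp add: matrix_matrix_mult_def vec_eq_iff ring_distribs sum.distrib)

lemma matrix_diff_mult: "(A - B) ** C = A ** C - B ** (C :: 'a::ring_1^'k^'n)"
  and matrix_mult_diff: "D ** (E - F) = D ** E - D ** (F :: 'b::ring_1^'k^'n)"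
  and matrix_uminus_mult: "(- A) ** C = - (A ** C)"
  and matrix_mult_uminus: "D ** (- E) = - (D ** E)"
  by (simp_all add: matrix_matrix_mult_def vec_eq_iff ring_distribs sum_subtractf sum_negf)

lemmas matrix_ring = matrix_add_mult matrix_add_ldistrib matrix_diff_mult matrix_mult_diff
  matrix_uminus_mult matrix_mult_uminus matrix_mul_assoc

lemma scaleR_matrix_mult: "(c *\<^sub>R A) ** B = c *\<^sub>R (A ** B)"
  and matrix_mult_scaleR: "A ** (c *\<^sub>R B) = c *\<^sub>R (A ** B)"
  for A :: "real^'n^'m" and B :: "real^'k^'n"
  by (simp_all add: matrix_matrix_mult_def vec_eq_iff sum_distrib_left mult_ac)

lemma transpose_zero: "transpose (0 :: real^'n^'m) = 0"
  by (simp add: transpose_def vec_eq_iff)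

lemma transpose_scaleR: "transpose (c *\<^sub>R A) = c *\<^sub>R transpose (A :: real^'n^'m)"
  by (simp add: transpose_def vec_eq_iff)

lemma bounded_bilinear_matrix_mult:
  "bounded_bilinear ((**) :: real^'n^'m \<Rightarrow> real^'k^'n \<Rightarrow> real^'k^'m)"
proof -
  have "bilinear ((**) :: real^'n^'m \<Rightarrow> real^'k^'n \<Rightarrow> real^'k^'m)"
    unfolding bilinear_def
    by (auto intro!: linearI
        simp: matrix_add_mult matrix_add_ldistrib scaleR_matrix_mult matrix_mult_scaleR)
  then show ?thesis
    using bilinear_conv_bounded_bilinear by blast
qed

lemmas continuous_on_matrix_mult [continuous_intros] =
  bounded_bilinear.continuous_on [OF bounded_bilinear_matrix_mult]

lemmas tendsto_matrix_mult [tendsto_intros] =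
  bounded_bilinear.tendsto [OF bounded_bilinear_matrix_mult]

lemma linear_transpose: "linear (transpose :: real^'n^'m \<Rightarrow> real^'m^'n)"
  by (rule linearI) (simp_all add: transpose_def vec_eq_iff)

lemmas continuous_on_transpose [continuous_intros] =
  bounded_linear.continuous_on [OF linear_conv_bounded_linear [THEN iffD1, OF linear_transpose]]

lemmas tendsto_transpose [tendsto_intros] =
  bounded_linear.tendsto [OF linear_conv_bounded_linear [THEN iffD1, OF linear_transpose]]

lemma inner_matrix: "A \<bullet> B = (\<Sum>i\<in>UNIV. \<Sum>j\<in>UNIV. A $ i $ j * B $ i $ j)"
  for A B :: "real^'n^'m"
  by (simp add: inner_vec_def)

lemma inner_transpose: "transpose A \<bullet> transpose B = A \<bullet> (B :: real^'n^'m)"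
  by (simp add: inner_matrix transpose_def sum.swap[of "\<lambda>i j. A $ j $ i * B $ j $ i"])

lemma inner_mult_left: "(A ** B) \<bullet> C = B \<bullet> (transpose A ** C)"
  for A :: "real^'n^'m" and B :: "real^'k^'n"
proof -
  have "(A ** B) \<bullet> C = (\<Sum>i\<in>UNIV. \<Sum>j\<in>UNIV. \<Sum>l\<in>UNIV. A$i$l * B$l$j * C$i$j)"
    by (simp add: inner_matrix matrix_matrix_mult_def sum_distrib_right)
  also have "\<dots> = (\<Sum>i\<in>UNIV. \<Sum>l\<in>UNIV. \<Sum>j\<in>UNIV. A$i$l * B$l$j * C$i$j)"
    by (intro sum.cong refl sum.swap)
  also have "\<dots> = (\<Sum>l\<in>UNIV. \<Sum>i\<in>UNIV. \<Sum>j\<in>UNIV. A$i$l * B$l$j * C$i$j)"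
    by (rule sum.swap)
  also have "\<dots> = (\<Sum>l\<in>UNIV. \<Sum>j\<in>UNIV. \<Sum>i\<in>UNIV. A$i$l * B$l$j * C$i$j)"
    by (intro sum.cong refl sum.swap)
  also have "\<dots> = B \<bullet> (transpose A ** C)"
    by (simp add: inner_matrix matrix_matrix_mult_def sum_distrib_left transpose_def mult_ac)
  finally show ?thesis .
qed

lemma inner_mult_right: "(A ** B) \<bullet> C = A \<bullet> (C ** transpose B)"
  for A :: "real^'n^'m" and B :: "real^'k^'n"
proof -
  have "(A ** B) \<bullet> C = (transpose B ** transpose A) \<bullet> transpose C"
    by (metis inner_transpose matrix_transpose_mul)
  also have "\<dots> = transpose A \<bullet> (B ** transpose C)"
    by (simp add: inner_mult_left)
  also have "\<dots> = A \<bullet> (C ** transpose B)"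
    by (metis inner_transpose matrix_transpose_mul transpose_transpose)
  finally show ?thesis .
qed

lemma orthogonal_matrixD:
  assumes "orthogonal_matrix g"
  shows "transpose g ** g = mat 1" "g ** transpose g = mat 1"
  using assms by (auto simp: orthogonal_matrix_def)

lemma linear_conj_act: "linear (conj_act (g :: real^'n^'n))"
  unfolding conj_act_def
  by (rule linearI)
    (simp_all add: matrix_add_mult matrix_add_ldistrib scaleR_matrix_mult matrix_mult_scaleR)

lemma conj_act_mult: "conj_act g (conj_act h A) = conj_act (g ** h) A"
  by (simp add: conj_act_def matrix_transpose_mul matrix_mul_assoc)

lemma conj_act_one [simp]: "conj_act (mat 1) A = A"
  by (simp add: conj_act_def)

lemma conj_act_inverse [simp]:
  assumes "orthogonal_matrix g"
  shows "conj_act (transpose g) (conj_act g A) = A" "conj_act g (conj_act (transpose g) A) = A"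
  using orthogonal_matrixD[OF assms] by (simp_all add: conj_act_mult)

lemma inj_conj_act: "orthogonal_matrix g \<Longrightarrow> inj (conj_act g)"
  by (metis conj_act_inverse(1) injI)

lemma inner_conj_act:
  "conj_act g A \<bullet> B = A \<bullet> conj_act (transpose g) B"
  unfolding conj_act_def inner_mult_right[of "g ** A"] inner_mult_left[of g A]
  by (simp add: matrix_mul_assoc)

lemma skew_conj_act: "skew_symmetric A \<Longrightarrow> skew_symmetric (conj_act g A)"
  unfolding skew_symmetric_def conj_act_def
  by (simp only: matrix_transpose_mul transpose_transpose matrix_uminus_mult matrix_mult_uminus matrix_mul_assoc)

lemma subspace_skew: "subspace {A :: real^'n^'n. skew_symmetric A}"
  unfolding subspace_def skew_symmetric_def
  by (simp add: transpose_add transpose_scaleR transpose_zero)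

lemma continuous_on_conj_act [continuous_intros]:
  "continuous_on S f \<Longrightarrow> continuous_on S g \<Longrightarrow> continuous_on S (\<lambda>x. conj_act (f x) (g x))"
  unfolding conj_act_def by (intro continuous_intros)

section \<open>Stabilisers of sets of skew-symmetric matrices\<close>

definition stabiliser :: "(real^'n^'n) set \<Rightarrow> (real^'n^'n) set" where
  "stabiliser C = {h. orthogonal_matrix h \<and> (\<forall>c\<in>C. h ** c = c ** h)}"

definition skew_commutant :: "(real^'n^'n) set \<Rightarrow> (real^'n^'n) set" where
  "skew_commutant C = {A. skew_symmetric A \<and> (\<forall>c\<in>C. A ** c = c ** A)}"

lemma stabiliser_empty: "stabiliser {} = {h. orthogonal_matrix h}"
  and skew_commutant_empty: "skew_commutant {} = {A. skew_symmetric A}"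
  by (simp_all add: stabiliser_def skew_commutant_def)

lemma subspace_skew_commutant: "subspace (skew_commutant C)"
  unfolding subspace_def skew_commutant_def skew_symmetric_def
  by (auto simp: transpose_add transpose_scaleR transpose_zero matrix_add_mult matrix_add_ldistrib
      scaleR_matrix_mult matrix_mult_scaleR)

lemma stabiliser_one: "mat 1 \<in> stabiliser C"
  by (simp add: stabiliser_def orthogonal_matrix_id)

lemma stabiliser_orthogonal: "h \<in> stabiliser C \<Longrightarrow> orthogonal_matrix h"
  by (simp add: stabiliser_def)

lemma stabiliser_mult:
  assumes "g \<in> stabiliser C" "h \<in> stabiliser C"
  shows "g ** h \<in> stabiliser C"
proof -
  have "(g ** h) ** c = c ** (g ** h)" if "c \<in> C" for c
  proof -
    have "(g ** h) ** c = g ** (c ** h)"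
      using assms(2) that by (simp add: stabiliser_def flip: matrix_mul_assoc)
    also have "\<dots> = (g ** c) ** h"
      by (simp add: matrix_mul_assoc)
    also have "\<dots> = c ** (g ** h)"
      using assms(1) that by (simp add: stabiliser_def matrix_mul_assoc)
    finally show ?thesis .
  qed
  then show ?thesis
    using assms by (simp add: stabiliser_def orthogonal_matrix_mul)
qed

lemma conj_act_stabiliser:
  assumes "h \<in> stabiliser C" "c \<in> C"
  shows "conj_act h c = c"
proof -
  have "conj_act h c = c ** (h ** transpose h)"
    using assms by (simp add: conj_act_def stabiliser_def matrix_mul_assoc)
  then show ?thesis
    using assms by (simp add: stabiliser_def orthogonal_matrixD)
qed

lemma stabiliserI:
  assumes "orthogonal_matrix h" "\<And>c. c \<in> C \<Longrightarrow> conj_act h c = c"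
  shows "h \<in> stabiliser C"
proof -
  have "h ** c = c ** h" if "c \<in> C" for c
  proof -
    have "c ** h = h ** c ** (transpose h ** h)"
      using assms(2)[OF that] by (simp add: conj_act_def matrix_mul_assoc)
    then show ?thesis
      using assms(1) by (simp add: orthogonal_matrixD)
  qed
  then show ?thesis
    using assms(1) by (simp add: stabiliser_def)
qed

lemma stabiliser_transpose:
  assumes "h \<in> stabiliser C"
  shows "transpose h \<in> stabiliser C"
proof (rule stabiliserI)
  show "orthogonal_matrix (transpose h)"
    using assms by (simp add: stabiliser_orthogonal)
  show "conj_act (transpose h) c = c" if "c \<in> C" for c
    using conj_act_inverse(1)[OF stabiliser_orthogonal[OF assms], of c] conj_act_stabiliser[OF assms that]
    by simp
qed

lemma conj_act_skew_commutant:
  assumes "h \<in> stabiliser C" "A \<in> skew_commutant C"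
  shows "conj_act h A \<in> skew_commutant C"
proof -
  have t: "transpose h ** c = c ** transpose h" if "c \<in> C" for c
    using stabiliser_transpose[OF assms(1)] that by (simp add: stabiliser_def)
  have "conj_act h A ** c = c ** conj_act h A" if "c \<in> C" for c
  proof -
    have "conj_act h A ** c = h ** (A ** c) ** transpose h"
      using t[OF that] by (simp add: conj_act_def flip: matrix_mul_assoc)
    also have "\<dots> = (h ** c) ** A ** transpose h"
      using assms that by (simp add: skew_commutant_def matrix_mul_assoc)
    also have "\<dots> = c ** conj_act h A"
      using assms that by (simp add: stabiliser_def conj_act_def matrix_mul_assoc)
    finally show ?thesis .
  qed
  then show ?thesis
    using assms(2) by (simp add: skew_commutant_def skew_conj_act)
qed

lemma norm_orthogonal_matrix:
  assumes "orthogonal_matrix (h :: real^'n^'n)"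
  shows "norm h = norm (mat 1 :: real^'n^'n)"
proof -
  have "h \<bullet> h = (h ** mat 1) \<bullet> h" by simp
  also have "\<dots> = mat 1 \<bullet> (mat 1 :: real^'n^'n)"
    unfolding inner_mult_left using assms by (simp add: orthogonal_matrixD)
  finally show ?thesis
    by (simp add: norm_eq_sqrt_inner)
qed

lemma compact_stabiliser: "compact (stabiliser (C :: (real^'n^'n) set))"
proof -
  have "stabiliser C = {h. transpose h ** h = mat 1} \<inter> (\<Inter>c\<in>C. {h. h ** c = c ** h})"
    by (auto simp: stabiliser_def orthogonal_matrix)
  moreover have "closed {h :: real^'n^'n. transpose h ** h = mat 1}"
    by (intro closed_Collect_eq continuous_intros)
  moreover have "closed {h :: real^'n^'n. h ** c = c ** h}" for c
    by (intro closed_Collect_eq continuous_intros)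
  ultimately have "closed (stabiliser C)"
    by (simp only:) (intro closed_Int closed_INT ballI; assumption)
  moreover have "bounded (stabiliser C)"
    by (rule boundedI[of _ "norm (mat 1 :: real^'n^'n)"])
      (simp add: stabiliser_def norm_orthogonal_matrix)
  ultimately show ?thesis
    by (simp add: compact_eq_bounded_closed)
qed

lemma skew_inner_zero:
  assumes "skew_symmetric X" shows "v \<bullet> (X *v v) = 0"
proof -
  have "v \<bullet> (X *v v) = (transpose X *v v) \<bullet> v"
    by (simp add: dot_lmul_matrix)
  also have "transpose X *v v = - (X *v v)"
    using assms unfolding skew_symmetric_def
    by (simp add: matrix_vector_mult_def vec_eq_iff sum_negf)
  finally show ?thesis by (simp add: inner_commute)
qed

text \<open>
  The Cayley transform \<open>(1 - X)\<^sup>-\<^sup>1 (1 + X)\<close> takes the place of the exponential. It is orthogonal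
  because \<open>1 + X\<close> is the transpose of \<open>1 - X\<close> and commutes with it, and it commutes with whatever
  commutes with \<open>X\<close>. The second property is \<open>(1 - X) h = 1 + X\<close> solved for \<open>h\<close>; for small \<open>X\<close> it
  says that \<open>h\<close> is \<open>1 + 2 X\<close> to first order.
\<close>

lemma cayley_transform:
  assumes X: "X \<in> skew_commutant C"
  obtains h where "h \<in> stabiliser C" "h = mat 1 + X ** (h + mat 1)"
proof -
  define M where "M = mat 1 - X"
  have tM: "transpose M = mat 1 + X"
    using X by (simp add: M_def skew_commutant_def skew_symmetric_def transpose_diff transpose_mat)
  have "v = 0" if "M *v v = 0" for v
  proof -
    have "v \<bullet> (v - X *v v) = 0"
      using that by (simp add: M_def matrix_vector_mult_diff_rdistrib)
    moreover have "v \<bullet> (X *v v) = 0"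
      using X by (simp add: skew_inner_zero skew_commutant_def)
    ultimately have "v \<bullet> v = 0"
      by (simp add: inner_diff_right)
    then show ?thesis by simp
  qed
  then obtain L where LM: "L ** M = mat 1"
    using matrix_left_invertible_ker by blast
  then have MinvL: "M ** L = mat 1"
    by (simp add: matrix_left_right_inverse)
  have comm: "M ** transpose M = transpose M ** M"
    unfolding tM by (simp add: M_def matrix_ring)
  define h where "h = L ** transpose M"
  have Mh: "M ** h = transpose M"
    by (simp add: h_def matrix_mul_assoc MinvL)
  have "h ** transpose h = L ** (transpose M ** M) ** transpose L"
    by (simp add: h_def matrix_transpose_mul matrix_mul_assoc)
  also have "\<dots> = (L ** M) ** transpose (L ** M)"
    by (simp flip: comm add: matrix_transpose_mul matrix_mul_assoc)
  finally have "h ** transpose h = mat 1"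
    by (simp add: LM transpose_mat)
  then have orth: "orthogonal_matrix h"
    using matrix_left_right_inverse by (auto simp: orthogonal_matrix)
  have "h ** c = c ** h" if c: "c \<in> C" for c
  proof -
    have Xc: "X ** c = c ** X"
      using X c by (simp add: skew_commutant_def)
    have "M ** (h ** c) = transpose M ** c"
      by (simp add: matrix_mul_assoc Mh)
    also have "\<dots> = c ** transpose M"
      by (simp add: tM matrix_ring Xc)
    also have "\<dots> = c ** (M ** h)"
      by (simp add: Mh)
    also have "\<dots> = M ** (c ** h)"
      by (simp add: M_def matrix_ring Xc)
    finally have "L ** (M ** (h ** c)) = L ** (M ** (c ** h))"
      by simp
    then show ?thesis
      by (simp add: matrix_mul_assoc LM)
  qed
  then have "h \<in> stabiliser C"
    using orth by (simp add: stabiliser_def)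
  moreover have "h = mat 1 + X ** (h + mat 1)"
    using Mh unfolding M_def tM[unfolded M_def] by (simp add: matrix_ring algebra_simps)
  ultimately show thesis by (rule that)
qed

text \<open>
  The first-order condition at the maximum. Along the Cayley transforms of \<open>t X\<close> the derivative at
  \<open>t = 0\<close> is a positive multiple of \<open>X A - A X\<close> paired with \<open>B\<close>, which equals \<open>X\<close> paired with
  \<open>A B - B A\<close>. It cannot be positive. The choice \<open>X = A B - B A\<close> is skew-symmetric and commutes with
  \<open>C\<close>, so it makes the squared norm of \<open>X\<close> nonpositive.
\<close>

lemma commute_at_maximum:
  fixes A B :: "real^'n^'n"
  assumes A: "A \<in> skew_commutant C" and B: "B \<in> skew_commutant C"
    and max: "\<And>h. h \<in> stabiliser C \<Longrightarrow> conj_act h A \<bullet> B \<le> A \<bullet> B"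
  shows "A ** B = B ** A"
proof -
  define X where "X = A ** B - B ** A"
  have tA: "transpose A = - A" and tB: "transpose B = - B"
    using A B by (auto simp: skew_commutant_def skew_symmetric_def)
  have "skew_symmetric X"
    by (simp add: skew_symmetric_def X_def transpose_diff matrix_transpose_mul tA tB matrix_ring)
  moreover have "X ** c = c ** X" if "c \<in> C" for c
  proof -
    have "A ** c = c ** A" "B ** c = c ** B"
      using A B that by (auto simp: skew_commutant_def)
    then show ?thesis
      unfolding X_def matrix_ring by (metis matrix_mul_assoc)
  qed
  ultimately have X: "X \<in> skew_commutant C"
    by (simp add: skew_commutant_def)
  define t where "t = (\<lambda>m. 1 / real (Suc m))"
  have t: "t \<longlonglongrightarrow> 0" "\<And>m. t m > 0"
    using LIMSEQ_inverse_real_of_nat by (simp_all add: t_def inverse_eq_divide)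
  have "\<exists>h. h \<in> stabiliser C \<and> h = mat 1 + (t m *\<^sub>R X) ** (h + mat 1)" for m
    using cayley_transform[OF subspace_scale[OF subspace_skew_commutant X]] by metis
  then obtain h where h: "\<And>m. h m \<in> stabiliser C"
    and h_eq: "\<And>m. h m = mat 1 + (t m *\<^sub>R X) ** (h m + mat 1)" by metis
  obtain K where "0 \<le> K" and K: "\<And>(A :: real^'n^'n) (B :: real^'n^'n). norm (A ** B) \<le> norm A * norm B * K"
    using bounded_bilinear.nonneg_bounded[OF bounded_bilinear_matrix_mult] by blast
  have "(\<lambda>m. h m - mat 1) \<longlonglongrightarrow> 0"
  proof (rule tendsto_norm_zero_cancel, rule Lim_null_comparison)
    show "\<forall>\<^sub>F m in sequentially. norm (norm (h m - mat 1))
      \<le> t m * (norm X * (2 * norm (mat 1 :: real^'n^'n)) * K)"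
    proof (intro always_eventually allI)
      fix m
      have le: "norm (h m + mat 1) \<le> 2 * norm (mat 1 :: real^'n^'n)"
        using norm_triangle_ineq[of "h m" "mat 1"] norm_orthogonal_matrix[OF stabiliser_orthogonal[OF h, of m]]
        by simp
      moreover have "h m - mat 1 = t m *\<^sub>R (X ** (h m + mat 1))"
        by (metis h_eq add_diff_cancel_left' scaleR_matrix_mult)
      then have "norm (h m - mat 1) = t m * norm (X ** (h m + mat 1))"
        using t(2)[of m] by simp
      also have "\<dots> \<le> t m * (norm X * norm (h m + mat 1) * K)"
        using t(2)[of m] by (intro mult_left_mono K) auto
      also have "\<dots> \<le> t m * (norm X * (2 * norm (mat 1 :: real^'n^'n)) * K)"
        using t(2)[of m] \<open>0 \<le> K\<close> le
        by (intro mult_left_mono mult_right_mono norm_ge_zero) simp_all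
      finally show "norm (norm (h m - mat 1)) \<le> t m * (norm X * (2 * norm (mat 1 :: real^'n^'n)) * K)"
        by simp
    qed
    show "(\<lambda>m. t m * (norm X * (2 * norm (mat 1 :: real^'n^'n)) * K)) \<longlonglongrightarrow> 0"
      by (rule tendsto_mult_left_zero[OF t(1)])
  qed
  then have "h \<longlonglongrightarrow> mat 1"
    by (rule LIM_zero_cancel)
  define E where "E = (\<lambda>m. X ** (h m + mat 1))"
  have "E \<longlonglongrightarrow> X ** (mat 1 + mat 1)"
    unfolding E_def by (intro tendsto_intros \<open>h \<longlonglongrightarrow> mat 1\<close>)
  then have E: "E \<longlonglongrightarrow> X + X"
    by (simp only: matrix_add_ldistrib matrix_mul_rid)
  have hE: "h m = mat 1 + t m *\<^sub>R E m" for m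
    unfolding E_def by (metis h_eq scaleR_matrix_mult)
  \<comment> \<open>The difference quotient of the inner product with \<open>B\<close> between the conjugates by \<open>h m\<close> and by \<open>1\<close>.\<close>
  define R where "R = (\<lambda>m. (E m ** A + A ** transpose (E m)
      + t m *\<^sub>R (E m ** A ** transpose (E m))) \<bullet> B)"
  have "R m \<le> 0" for m
  proof -
    have "conj_act (h m) A = A + t m *\<^sub>R (E m ** A + A ** transpose (E m)
      + t m *\<^sub>R (E m ** A ** transpose (E m)))"
      unfolding conj_act_def hE transpose_add transpose_scaleR transpose_mat matrix_add_mult
        matrix_add_ldistrib scaleR_matrix_mult matrix_mult_scaleR matrix_mul_lid matrix_mul_rid
      by (simp add: scaleR_add_right)
    then have "t m * R m \<le> 0"
      using max[OF h, of m] by (simp add: R_def inner_add_left)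
    then show ?thesis
      using t(2)[of m] by (simp add: mult_le_0_iff)
  qed
  moreover have "R \<longlonglongrightarrow> ((X + X) ** A + A ** transpose (X + X)
      + 0 *\<^sub>R ((X + X) ** A ** transpose (X + X))) \<bullet> B"
    unfolding R_def by (intro tendsto_intros E t)
  ultimately have "((X + X) ** A + A ** transpose (X + X)) \<bullet> B \<le> 0"
    using LIMSEQ_le_const2 by fastforce
  then have "(X ** A) \<bullet> B + (A ** transpose X) \<bullet> B \<le> 0"
    unfolding matrix_add_mult transpose_add matrix_add_ldistrib inner_add_left by linarith
  moreover have "(X ** A) \<bullet> B = - (X \<bullet> (B ** A))"
    unfolding inner_mult_right tA matrix_mult_uminus by (rule inner_minus_right)
  moreover have "(A ** transpose X) \<bullet> B = X \<bullet> (A ** B)"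
    using \<open>skew_symmetric X\<close>
    unfolding inner_mult_left skew_symmetric_def tA matrix_uminus_mult by simp
  ultimately have "X \<bullet> (A ** B) - X \<bullet> (B ** A) \<le> 0"
    by linarith
  then have "X \<bullet> X \<le> 0"
    unfolding inner_diff_right[symmetric] X_def[symmetric] .
  then have "X = 0"
    by (metis inner_eq_zero_iff inner_ge_zero order_antisym)
  then show ?thesis
    by (simp add: X_def)
qed

section \<open>The normal form of a skew-symmetric matrix\<close>

lemma skew_symmetricD:
  assumes "skew_symmetric A" shows "A $ l $ i = - A $ i $ l"
proof -
  have "transpose A $ i $ l = (- A) $ i $ l"
    using assms by (simp only: skew_symmetric_def)
  then show ?thesis
    by (simp only: transpose_def vec_lambda_beta vector_uminus_component)
qed

text \<open>
  An unordered version of the block structure: \<open>K\<close> is the set of rows of the upper right block, and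
  \<open>\<tau>\<close> exchanges such a row with the column in which the skew-diagonal meets it. There is at most one
  further index, the middle one of an odd dimension. The space \<open>\<real>\<^sup>k\<close> consists of the vectors that are
  supported in \<open>K\<close>.
\<close>

locale index_pairing =
  fixes K :: "'n::finite set" and \<tau> :: "'n \<Rightarrow> 'n"
  assumes invol [simp]: "\<tau> (\<tau> i) = i"
    and tau_notin: "i \<in> K \<Longrightarrow> \<tau> i \<notin> K"
    and middle_unique: "i \<notin> K \<Longrightarrow> \<tau> i \<notin> K \<Longrightarrow> l \<notin> K \<Longrightarrow> \<tau> l \<notin> K \<Longrightarrow> i = l"
begin

lemma tau_eq_iff: "\<tau> i = l \<longleftrightarrow> i = \<tau> l"
  by auto

lemma bij_tau: "bij \<tau>"
  by (rule involuntory_imp_bij) simp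

lemma middle_fixed: "i \<notin> K \<Longrightarrow> \<tau> i \<notin> K \<Longrightarrow> \<tau> i = i"
  using middle_unique[of "\<tau> i" i] by simp

definition supported :: "(real^'n) set" where
  "supported = {x. \<forall>i. i \<notin> K \<longrightarrow> x $ i = 0}"

text \<open>
  The entry of the normal form of \<open>x\<close> in row \<open>i\<close>, at column \<open>\<tau> i\<close>.
\<close>

definition signed_coord :: "real^'n \<Rightarrow> 'n \<Rightarrow> real" where
  "signed_coord x i = (if i \<in> K then x $ i else if \<tau> i \<in> K then - x $ \<tau> i else 0)"

definition normal_form :: "real^'n \<Rightarrow> real^'n^'n" where
  "normal_form x = (\<chi> i l. if l = \<tau> i then signed_coord x i else 0)"

definition skew_diag :: "real^'n^'n \<Rightarrow> real^'n" where
  "skew_diag A = (\<chi> i. if i \<in> K then A $ i $ \<tau> i else 0)"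

lemma signed_coord_tau: "signed_coord x (\<tau> i) = - signed_coord x i"
  using tau_notin by (auto simp: signed_coord_def)

lemma skew_normal_form: "skew_symmetric (normal_form x)"
  unfolding skew_symmetric_def
  by (auto simp: normal_form_def transpose_def vec_eq_iff signed_coord_tau)

lemma linear_skew_diag: "linear skew_diag"
  by (rule linearI) (simp_all add: skew_diag_def vec_eq_iff)

lemma skew_diag_supported: "skew_diag A \<in> supported"
  by (simp add: skew_diag_def supported_def)

lemma subspace_supported: "subspace supported"
  by (auto simp: subspace_def supported_def)

lemma linear_normal_form: "linear normal_form"
  by (rule linearI) (simp_all add: normal_form_def signed_coord_def vec_eq_iff)

lemma skew_diag_normal_form: "x \<in> supported \<Longrightarrow> skew_diag (normal_form x) = x"
  by (auto simp: skew_diag_def normal_form_def vec_eq_iff supported_def signed_coord_def)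

lemma normal_form_skew_diag:
  assumes "skew_symmetric A" and zero: "\<And>i l. l \<noteq> \<tau> i \<Longrightarrow> A $ i $ l = 0"
  shows "normal_form (skew_diag A) = A"
proof -
  have skew: "A $ l $ i = - A $ i $ l" for i l
    using assms(1) by (rule skew_symmetricD)
  have "signed_coord (skew_diag A) i = A $ i $ \<tau> i" for i
  proof -
    consider "i \<in> K" | "\<tau> i \<in> K" "i \<notin> K" | "i \<notin> K" "\<tau> i \<notin> K" by blast
    then show ?thesis
    proof cases
      case 2
      then show ?thesis
        using skew[of i "\<tau> i"] by (simp add: signed_coord_def skew_diag_def)
    next
      case 3
      have "A $ i $ i = 0"
        using skew[of i i] by linarith
      then show ?thesis
        using 3 middle_fixed[OF 3] by (simp add: signed_coord_def)
    qed (simp add: signed_coord_def skew_diag_def)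
  qed
  then show ?thesis
    using zero by (simp add: normal_form_def vec_eq_iff)
qed

text \<open>
  Every pair of indices contributes two equal terms, as both matrices change sign under transposition.
  This identity translates linear functionals on the orbitope that are given by normal forms into
  functionals on the permutahedron.
\<close>

lemma inner_normal_form:
  assumes "skew_symmetric A"
  shows "normal_form y \<bullet> A = 2 * (y \<bullet> skew_diag A)"
proof -
  have skew: "A $ l $ i = - A $ i $ l" for i l
    using assms by (rule skew_symmetricD)
  define f where "f = (\<lambda>i. if i \<in> K then y $ i * A $ i $ \<tau> i else 0)"
  have "normal_form y \<bullet> A = (\<Sum>i\<in>UNIV. \<Sum>l\<in>UNIV. if l = \<tau> i then signed_coord y i * A $ i $ l else 0)"
    unfolding inner_matrix normal_form_def by (intro sum.cong refl) simp
  also have "\<dots> = (\<Sum>i\<in>UNIV. signed_coord y i * A $ i $ \<tau> i)"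
    by simp
  also have "\<dots> = (\<Sum>i\<in>UNIV. f i + f (\<tau> i))"
  proof (rule sum.cong[OF refl])
    fix i
    show "signed_coord y i * A $ i $ \<tau> i = f i + f (\<tau> i)"
      using tau_notin skew[of i "\<tau> i"] by (auto simp: signed_coord_def f_def)
  qed
  also have "\<dots> = 2 * (\<Sum>i\<in>UNIV. f i)"
    using sum.reindex_bij_betw[OF bij_tau, of f] by (simp add: sum.distrib)
  also have "(\<Sum>i\<in>UNIV. f i) = y \<bullet> skew_diag A"
    by (auto simp: inner_vec_def f_def skew_diag_def intro!: sum.cong)
  finally show ?thesis .
qed

lemma normal_form_mult: "(normal_form x ** A) $ i $ l = signed_coord x i * A $ \<tau> i $ l"
proof -
  have "(normal_form x ** A) $ i $ l = (\<Sum>m\<in>UNIV. if m = \<tau> i then signed_coord x i * A $ m $ l else 0)"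
    unfolding matrix_matrix_mult_def normal_form_def vec_lambda_beta by (intro sum.cong refl) auto
  then show ?thesis by simp
qed

lemma mult_normal_form: "(A ** normal_form x) $ i $ l = - A $ i $ \<tau> l * signed_coord x l"
proof -
  have "(A ** normal_form x) $ i $ l = (\<Sum>m\<in>UNIV. if m = \<tau> l then A $ i $ m * signed_coord x m else 0)"
    unfolding matrix_matrix_mult_def normal_form_def vec_lambda_beta by (intro sum.cong refl) auto
  then show ?thesis by (simp add: signed_coord_tau)
qed

text \<open>
  The product of two normal forms is diagonal, with the entry \<open>- x\<^sub>i y\<^sub>i\<close> at both members of a pair.
\<close>

lemma normal_form_commute: "normal_form x ** normal_form y = normal_form y ** normal_form x"
  by (simp add: vec_eq_iff normal_form_mult) (auto simp: normal_form_def signed_coord_tau)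

text \<open>
  Commuting with the normal form of \<open>r\<close> gives \<open>A\<^sub>i\<^sub>l (r\<^sub>l\<^sup>2 - r\<^sub>i\<^sup>2) = 0\<close>, where both indices of a pair carry
  the same square and the middle index carries \<open>0\<close>. Only entries within a pair can survive, and those
  on the diagonal vanish by skew-symmetry.
\<close>

lemma commute_regular:
  assumes A: "skew_symmetric A" and comm: "A ** normal_form r = normal_form r ** A"
    and pos: "\<And>i. r $ i > 0" and inj: "inj (\<lambda>i. r $ i)"
  shows "normal_form (skew_diag A) = A"
proof (rule normal_form_skew_diag[OF A])
  fix i l assume l: "l \<noteq> \<tau> i"
  have skew: "A $ l $ i = - A $ i $ l" for i l
    using A by (rule skew_symmetricD)
  have eq: "- A $ i $ \<tau> l * signed_coord r l = signed_coord r i * A $ \<tau> i $ l" for i l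
    using comm mult_normal_form normal_form_mult by metis
  have 1: "A $ i $ l * signed_coord r l = signed_coord r i * A $ \<tau> i $ \<tau> l"
    using eq[of i "\<tau> l"] by (simp add: signed_coord_tau)
  have 2: "A $ \<tau> i $ \<tau> l * signed_coord r l = signed_coord r i * A $ i $ l"
    using eq[of "\<tau> i" l] by (simp add: signed_coord_tau)
  have "A $ i $ l * (signed_coord r l)\<^sup>2 = signed_coord r i * (A $ \<tau> i $ \<tau> l * signed_coord r l)"
    unfolding power2_eq_square using 1 by (metis mult.assoc)
  also have "\<dots> = A $ i $ l * (signed_coord r i)\<^sup>2"
    unfolding 2 by (simp add: power2_eq_square)
  finally have "A $ i $ l * (signed_coord r l)\<^sup>2 = A $ i $ l * (signed_coord r i)\<^sup>2" .
  then have "A $ i $ l = 0 \<or> (signed_coord r l)\<^sup>2 = (signed_coord r i)\<^sup>2"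
    by simp
  moreover have "i = l" if "(signed_coord r l)\<^sup>2 = (signed_coord r i)\<^sup>2"
  proof (rule ccontr)
    assume "i \<noteq> l"
    have "\<bar>signed_coord r l\<bar> = \<bar>signed_coord r i\<bar>"
      using that by (simp add: power2_eq_iff abs_eq_iff)
    moreover have "\<bar>signed_coord r m\<bar> =
        (if m \<in> K then r $ m else if \<tau> m \<in> K then r $ \<tau> m else 0)" for m
      using pos[of m] pos[of "\<tau> m"] by (simp add: signed_coord_def)
    ultimately have eq: "(if l \<in> K then r $ l else if \<tau> l \<in> K then r $ \<tau> l else 0) =
        (if i \<in> K then r $ i else if \<tau> i \<in> K then r $ \<tau> i else 0)"
      by simp
    have rinj: "r $ a = r $ b \<longleftrightarrow> a = b" for a b
      using inj by (auto dest: injD)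
    have r0: "r $ a \<noteq> 0" "0 \<noteq> r $ a" for a
      using pos[of a] by simp_all
    have "l \<noteq> i" "\<tau> l \<noteq> i" "l \<noteq> \<tau> i" "\<tau> l \<noteq> \<tau> i"
      using l \<open>i \<noteq> l\<close> by (metis invol)+
    then show False
      using eq middle_unique[of i l] by (simp add: rinj r0 split: if_splits)
  qed
  moreover have "A $ i $ i = 0"
    using skew[of i i] by linarith
  ultimately show "A $ i $ l = 0"
    by auto
qed

text \<open>
  Among all conjugates by the stabiliser of \<open>C\<close>, which is compact, take one with maximal inner product
  with a regular normal form. It commutes with that normal form and so has normal form itself.
\<close>

lemma simultaneous_normal_form:
  assumes C: "C \<subseteq> range normal_form" and Z: "Z \<in> skew_commutant C"
  obtains h x where "h \<in> stabiliser C" "x \<in> supported" "conj_act h Z = normal_form x"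
proof -
  obtain f :: "'n \<Rightarrow> nat" where f: "inj f"
    using finite_imp_inj_to_nat_seg[of "UNIV :: 'n set"] by auto
  \<comment> \<open>An arbitrary point with distinct positive coordinates.\<close>
  define r :: "real^'n" where "r = (\<chi> i. real (Suc (f i)))"
  have pos: "r $ i > 0" for i
    by (simp add: r_def)
  have inj: "inj (\<lambda>i. r $ i)"
    using f by (simp add: r_def inj_def)
  have "\<exists>h\<in>stabiliser C. \<forall>g\<in>stabiliser C. conj_act g Z \<bullet> normal_form r \<le> conj_act h Z \<bullet> normal_form r"
    using stabiliser_one
    by (intro continuous_attains_sup compact_stabiliser continuous_intros) auto
  then obtain h where h: "h \<in> stabiliser C"
    and max: "\<And>g. g \<in> stabiliser C \<Longrightarrow> conj_act g Z \<bullet> normal_form r \<le> conj_act h Z \<bullet> normal_form r"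
    by blast
  have hZ: "conj_act h Z \<in> skew_commutant C"
    by (rule conj_act_skew_commutant[OF h Z])
  have "normal_form r \<in> skew_commutant C"
    using C normal_form_commute by (auto simp: skew_commutant_def skew_normal_form)
  from hZ this have "conj_act h Z ** normal_form r = normal_form r ** conj_act h Z"
    by (rule commute_at_maximum) (simp add: conj_act_mult max stabiliser_mult h)
  then have "normal_form (skew_diag (conj_act h Z)) = conj_act h Z"
    using hZ pos inj by (intro commute_regular) (auto simp: skew_commutant_def)
  then show thesis
    using that[OF h skew_diag_supported] by metis
qed

section \<open>Signed permutations\<close>

text \<open>
  The group \<open>B\<^sub>k\<close> acts on all of \<open>\<real>\<^sup>n\<close> here: permutations fix the indices outside \<open>K\<close>, but signs are
  allowed there as well. This makes every element invertible and does not change the action on vectors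
  that are supported in \<open>K\<close>.
\<close>

definition signed_perm :: "('n \<Rightarrow> 'n) \<Rightarrow> ('n \<Rightarrow> real) \<Rightarrow> real^'n \<Rightarrow> real^'n" where
  "signed_perm \<rho> s x = (\<chi> i. s i * x $ \<rho> i)"

definition weyl :: "(real^'n \<Rightarrow> real^'n) set" where
  "weyl = {signed_perm \<rho> s | \<rho> s. \<rho> permutes K \<and> (\<forall>i. s i \<in> {1, - 1})}"

lemma linear_signed_perm: "linear (signed_perm \<rho> s)"
  by (rule linearI) (simp_all add: signed_perm_def vec_eq_iff algebra_simps)

lemma linear_weyl: "w \<in> weyl \<Longrightarrow> linear w"
  by (auto simp: weyl_def linear_signed_perm)

lemma weyl_supported:
  assumes "w \<in> weyl" "x \<in> supported" shows "w x \<in> supported"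
proof -
  obtain \<rho> s where "w = signed_perm \<rho> s" "\<rho> permutes K"
    using assms(1) by (auto simp: weyl_def)
  then show ?thesis
    using assms(2) by (simp add: supported_def signed_perm_def permutes_not_in)
qed

lemma weyl_comp:
  assumes "v \<in> weyl" "w \<in> weyl" shows "v \<circ> w \<in> weyl"
proof -
  obtain \<rho> s where v: "v = signed_perm \<rho> s" "\<rho> permutes K" "\<forall>i. s i \<in> {1, - 1}"
    using assms(1) by (auto simp: weyl_def)
  obtain \<rho>' s' where w: "w = signed_perm \<rho>' s'" "\<rho>' permutes K" "\<forall>i. s' i \<in> {1, - 1}"
    using assms(2) by (auto simp: weyl_def)
  have "v \<circ> w = signed_perm (\<rho>' \<circ> \<rho>) (\<lambda>i. s i * s' (\<rho> i))"
    by (simp add: v w signed_perm_def fun_eq_iff mult_ac)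
  moreover have "(\<rho>' \<circ> \<rho>) permutes K"
    using v w by (simp add: permutes_compose)
  moreover have "s i * s' (\<rho> i) \<in> {1, - 1}" for i
    using v(3)[rule_format, of i] w(3)[rule_format, of "\<rho> i"] by auto
  ultimately show ?thesis
    unfolding weyl_def by blast
qed

lemma weyl_inverse:
  assumes "w \<in> weyl"
  obtains v where "v \<in> weyl" "v \<circ> w = id" "w \<circ> v = id"
proof -
  obtain \<rho> s where w: "w = signed_perm \<rho> s" "\<rho> permutes K" "\<forall>i. s i \<in> {1, - 1}"
    using assms by (auto simp: weyl_def)
  define v where "v = signed_perm (inv \<rho>) (\<lambda>i. s (inv \<rho> i))"
  have ss: "s i * s i = 1" for i
    using w(3)[rule_format, of i] by auto
  have inv: "\<rho> (inv \<rho> i) = i" "inv \<rho> (\<rho> i) = i" for i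
    using w(2) permutes_inverses by metis+
  have "v \<in> weyl"
    using w permutes_inv unfolding weyl_def v_def by blast
  moreover have "v \<circ> w = id" "w \<circ> v = id"
    by (simp_all add: v_def w signed_perm_def fun_eq_iff vec_eq_iff inv ss flip: mult.assoc)
  ultimately show thesis by (rule that)
qed

text \<open>
  A monomial matrix does it: it permutes the pairs of indices as the signed permutation does,
  consistently on both members, and it changes the sign of only one member of a pair.
\<close>

lemma weyl_realised_by_conj_act:
  assumes "w \<in> weyl"
  obtains g where "orthogonal_matrix g" "\<And>x. conj_act g (normal_form x) = normal_form (w x)"
proof -
  obtain \<rho> s where w: "w = signed_perm \<rho> s" "\<rho> permutes K" "\<forall>i. s i \<in> {1, - 1}"
    using assms by (auto simp: weyl_def)
  have inK: "\<rho> i \<in> K \<longleftrightarrow> i \<in> K" "inv \<rho> i \<in> K \<longleftrightarrow> i \<in> K" for i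
    using w(2) permutes_in_image permutes_inv by metis+
  have inv: "inv \<rho> (\<rho> i) = i" for i
    using w(2) permutes_inverses by metis
  \<comment> \<open>A permutation of \<open>K\<close> acts on all indices such that it commutes with \<open>\<tau>\<close>.\<close>
  define ext where "ext = (\<lambda>\<rho> i. if i \<in> K then \<rho> i else if \<tau> i \<in> K then \<tau> (\<rho> (\<tau> i)) else i)"
  have ext_tau: "ext \<rho> (\<tau> i) = \<tau> (ext \<rho> i)" for i
    using tau_notin by (auto simp: ext_def)
  have "ext (inv \<rho>) (ext \<rho> i) = i" for i
    using tau_notin by (auto simp: ext_def inK inv)
  then have inj: "ext \<rho> i = ext \<rho> l \<longleftrightarrow> i = l" for i l
    by metis
  define t where "t = (\<lambda>i. if i \<in> K then s i else 1)"
  have tt: "t i * t i = 1" for i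
    using w(3)[rule_format, of i] by (auto simp: t_def)
  define g :: "real^'n^'n" where "g = (\<chi> i l. if l = ext \<rho> i then t i else 0)"
  have gA: "(g ** A) $ i $ l = t i * A $ ext \<rho> i $ l" for A :: "real^'n^'n" and i l
  proof -
    have "(g ** A) $ i $ l = (\<Sum>m\<in>UNIV. if m = ext \<rho> i then t i * A $ m $ l else 0)"
      unfolding matrix_matrix_mult_def g_def vec_lambda_beta by (intro sum.cong refl) auto
    then show ?thesis by simp
  qed
  have Ag: "(A ** transpose g) $ i $ l = A $ i $ ext \<rho> l * t l" for A :: "real^'n^'n" and i l
  proof -
    have "(A ** transpose g) $ i $ l = (\<Sum>m\<in>UNIV. if m = ext \<rho> l then A $ i $ m * t l else 0)"
      unfolding matrix_matrix_mult_def g_def transpose_def vec_lambda_beta by (intro sum.cong refl) auto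
    then show ?thesis by simp
  qed
  have "g ** transpose g = mat 1"
    by (simp add: vec_eq_iff gA) (simp add: g_def transpose_def mat_def inj tt)
  then have "orthogonal_matrix g"
    by (simp add: matrix_left_right_inverse orthogonal_matrix)
  moreover have "conj_act g (normal_form x) = normal_form (w x)" for x
  proof -
    have "signed_coord (w x) i = t i * t (\<tau> i) * signed_coord x (ext \<rho> i)" for i
      using tau_notin by (auto simp: signed_coord_def w signed_perm_def t_def ext_def inK)
    then show ?thesis
      by (simp add: vec_eq_iff conj_act_def Ag gA)
        (simp add: normal_form_def inj flip: ext_tau)
  qed
  ultimately show thesis by (rule that)
qed

end

section \<open>The characteristic polynomial\<close>

lemma complexify_mult: "complexify (A ** B) = complexify A ** complexify B"
  by (simp add: complexify_def matrix_matrix_mult_def vec_eq_iff)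

lemma complexify_one: "complexify (mat 1) = mat 1"
  by (simp add: complexify_def mat_def vec_eq_iff)

lemma mat_mult: "mat z ** A = (\<chi> i j. z * A $ i $ j)"
  and mult_mat: "A ** mat z = (\<chi> i j. z * A $ i $ j)"
  for A :: "complex^'n^'n"
proof -
  have "(mat z ** A) $ i $ j = (\<Sum>k\<in>UNIV. if k = i then z * A $ k $ j else 0)" for i j
    unfolding matrix_matrix_mult_def mat_def vec_lambda_beta by (intro sum.cong refl) auto
  then show "mat z ** A = (\<chi> i j. z * A $ i $ j)"
    by (simp add: vec_eq_iff)
  have "(A ** mat z) $ i $ j = (\<Sum>k\<in>UNIV. if k = j then z * A $ i $ k else 0)" for i j
    unfolding matrix_matrix_mult_def mat_def vec_lambda_beta by (intro sum.cong refl) auto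
  then show "A ** mat z = (\<chi> i j. z * A $ i $ j)"
    by (simp add: vec_eq_iff)
qed

lemma charpoly_conj_act:
  assumes "orthogonal_matrix g"
  shows "det (mat z - complexify (conj_act g A)) = det (mat z - complexify A)"
proof -
  define G H where "G = complexify g" and "H = complexify (transpose g)"
  have GH: "G ** H = mat 1"
    unfolding G_def H_def complexify_mult[symmetric]
    using assms by (simp add: orthogonal_matrixD complexify_one)
  have "G ** (mat z - complexify A) ** H = mat z ** (G ** H) - complexify (conj_act g A)"
    by (simp add: conj_act_def complexify_mult matrix_mult_diff matrix_diff_mult matrix_mul_assoc
        mat_mult mult_mat flip: G_def H_def)
  also have "mat z ** (G ** H) = mat z"
    by (simp add: GH)
  finally have "det (mat z - complexify (conj_act g A)) = det (G ** (mat z - complexify A) ** H)"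
    by simp
  also have "\<dots> = det (G ** H) * det (mat z - complexify A)"
    by (simp add: det_mul)
  finally show ?thesis
    by (simp add: GH)
qed

text \<open>
  Each factor is \<open>z\<^sup>2 + a\<^sub>i\<^sup>2\<close>. As a polynomial in \<open>w = z\<^sup>2\<close> the product has the roots \<open>- a\<^sub>i\<^sup>2\<close>, and these
  determine the absolute values. The power of \<open>z\<close> can be cancelled for \<open>w \<noteq> 0\<close> only; an additional
  factor \<open>w\<close> makes the two sides equal everywhere.
\<close>

lemma abs_roots_eq_if_prod_eq:
  fixes a b :: "'k \<Rightarrow> real"
  assumes K: "finite K"
    and eq: "\<And>z. z ^ m * (\<Prod>i\<in>K. (z - \<i> * complex_of_real (a i)) * (z + \<i> * complex_of_real (a i))) =
      z ^ m * (\<Prod>i\<in>K. (z - \<i> * complex_of_real (b i)) * (z + \<i> * complex_of_real (b i)))"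
  shows "image_mset (\<lambda>i. \<bar>a i\<bar>) (mset_set K) = image_mset (\<lambda>i. \<bar>b i\<bar>) (mset_set K)"
proof -
  define p where "p = (\<lambda>c :: 'k \<Rightarrow> real. \<Prod>i\<in>K. [:complex_of_real ((c i)\<^sup>2), 1:])"
  have roots: "image_mset (\<lambda>w. sqrt (- Re w)) (proots (p c)) = image_mset (\<lambda>i. \<bar>c i\<bar>) (mset_set K)" for c
  proof -
    have "proots (p c) = image_mset (\<lambda>i. - complex_of_real ((c i)\<^sup>2)) (mset_set K)"
      unfolding p_def using K
    proof (induction K rule: finite_induct)
      case (insert i K)
      have "(\<Prod>i\<in>K. [:complex_of_real ((c i)\<^sup>2), 1:]) \<noteq> 0"
        using insert.hyps by (simp add: prod_zero_iff)
      then show ?case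
        using insert by (simp add: proots_mult del: mult_pCons_left)
    qed simp
    then show ?thesis
      by (simp add: multiset.map_comp comp_def)
  qed
  have poly_p: "poly (p c) (z\<^sup>2) = (\<Prod>i\<in>K. (z - \<i> * complex_of_real (c i)) * (z + \<i> * complex_of_real (c i)))" for c z
    unfolding p_def poly_prod by (intro prod.cong refl) (simp add: algebra_simps power2_eq_square)
  have "poly ([:0, 1:] * p a) w = poly ([:0, 1:] * p b) w" for w
  proof -
    have "poly (p a) w = poly (p b) w" if "w \<noteq> 0"
      using eq[of "csqrt w"] that unfolding poly_p[symmetric] by simp
    then show ?thesis by auto
  qed
  then have "[:0, 1:] * p a = [:0, 1:] * p b"
    by (metis poly_eq_poly_eq_iff ext)
  then have "p a = p b"
    by simp
  then show ?thesis
    using roots by metis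
qed

context index_pairing
begin

text \<open>
  Let \<open>T\<close> be the permutation matrix of \<open>\<tau>\<close>. The matrix \<open>U = 1 + \<i> T\<close> is invertible, because
  \<open>(1 + \<i> T) (1 - \<i> T) = 2\<close>, and it intertwines the normal form with the diagonal matrix whose entries
  are \<open>\<i>\<close> times the signed coordinates.
\<close>

lemma charpoly_normal_form:
  "det (mat z - complexify (normal_form x)) = z ^ (CARD('n) - 2 * card K) *
    (\<Prod>i\<in>K. (z - \<i> * complex_of_real (x $ i)) * (z + \<i> * complex_of_real (x $ i)))"
proof -
  define U V D :: "complex^'n^'n"
    where "U = (\<chi> i l. (if l = i then 1 else 0) + \<i> * (if l = \<tau> i then 1 else 0))"
      and "V = (\<chi> i l. (if l = i then 1 else 0) - \<i> * (if l = \<tau> i then 1 else 0))"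
      and "D = (\<chi> i l. if l = i then z - \<i> * complex_of_real (signed_coord x i) else 0)"
  define S where "S = mat z - complexify (normal_form x)"
  have UA: "(U ** A) $ i $ l = A $ i $ l + \<i> * A $ \<tau> i $ l" for A :: "complex^'n^'n" and i l
  proof -
    have "(U ** A) $ i $ l = (\<Sum>m\<in>UNIV. (if m = i then A $ m $ l else 0) + \<i> * (if m = \<tau> i then A $ m $ l else 0))"
      unfolding matrix_matrix_mult_def U_def vec_lambda_beta
      by (intro sum.cong refl) (simp add: distrib_right)
    then show ?thesis by (simp add: sum.distrib flip: sum_distrib_left)
  qed
  have AU: "(A ** U) $ i $ l = A $ i $ l + \<i> * A $ i $ \<tau> l" for A :: "complex^'n^'n" and i l
  proof -
    have "(A ** U) $ i $ l = (\<Sum>m\<in>UNIV. (if m = l then A $ i $ m else 0) + \<i> * (if m = \<tau> l then A $ i $ m else 0))"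
      unfolding matrix_matrix_mult_def U_def vec_lambda_beta
      by (intro sum.cong refl) (auto simp: distrib_left)
    then show ?thesis by (simp add: sum.distrib flip: sum_distrib_left)
  qed
  have "U ** V = mat 2"
    by (auto simp: vec_eq_iff UA) (auto simp: V_def mat_def tau_eq_iff algebra_simps)
  then have "det U * det V = det (mat 2 :: complex^'n^'n)"
    by (simp flip: det_mul)
  also have "\<dots> = 2 ^ CARD('n)"
    by (subst det_diagonal) (simp_all add: mat_def)
  finally have U: "det U \<noteq> 0"
    by auto
  have mid: "signed_coord x i = 0" if "i = \<tau> i" for i
    using tau_notin[of i] that by (auto simp: signed_coord_def)
  have "S ** U = U ** D"
    by (auto simp: vec_eq_iff UA AU)
      (auto simp: S_def D_def mat_def complexify_def normal_form_def tau_eq_iff signed_coord_tau mid algebra_simps)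
  then have "det S * det U = det U * det D"
    by (simp flip: det_mul)
  then have "det S = det D"
    using U by simp
  also have "\<dots> = (\<Prod>i\<in>UNIV. z - \<i> * complex_of_real (signed_coord x i))"
    by (subst det_diagonal) (simp_all add: D_def)
  also have "\<dots> = (\<Prod>i\<in>UNIV - (K \<union> \<tau> ` K). z - \<i> * complex_of_real (signed_coord x i)) *
      (\<Prod>i\<in>K \<union> \<tau> ` K. z - \<i> * complex_of_real (signed_coord x i))"
    by (rule prod.subset_diff) simp_all
  also have "(\<Prod>i\<in>UNIV - (K \<union> \<tau> ` K). z - \<i> * complex_of_real (signed_coord x i)) =
      (\<Prod>i\<in>UNIV - (K \<union> \<tau> ` K). z)"
    by (intro prod.cong refl) (auto simp: signed_coord_def image_iff tau_eq_iff)
  also have "\<dots> = z ^ (CARD('n) - 2 * card K)"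
  proof -
    have "card (K \<union> \<tau> ` K) = 2 * card K"
      using tau_notin by (subst card_Un_disjoint) (auto simp: card_image inj_on_def tau_eq_iff)
    then show ?thesis
      by (simp add: card_Diff_subset)
  qed
  also have "(\<Prod>i\<in>K \<union> \<tau> ` K. z - \<i> * complex_of_real (signed_coord x i)) =
      (\<Prod>i\<in>K. z - \<i> * complex_of_real (signed_coord x i)) *
      (\<Prod>i\<in>\<tau> ` K. z - \<i> * complex_of_real (signed_coord x i))"
    using tau_notin by (intro prod.union_disjoint) auto
  also have "(\<Prod>i\<in>\<tau> ` K. z - \<i> * complex_of_real (signed_coord x i)) =
      (\<Prod>i\<in>K. z + \<i> * complex_of_real (signed_coord x i))"
    by (subst prod.reindex) (auto simp: inj_on_def tau_eq_iff signed_coord_tau)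
  finally show ?thesis
    by (simp add: S_def prod.distrib signed_coord_def)
qed

lemma charpoly_eq_imp_weyl:
  assumes "x \<in> supported" "y \<in> supported"
    and charpoly: "\<And>z. det (mat z - complexify (normal_form x)) = det (mat z - complexify (normal_form y))"
  obtains w where "w \<in> weyl" "y = w x"
proof -
  have "image_mset (\<lambda>i. \<bar>y $ i\<bar>) (mset_set K) = image_mset (\<lambda>i. \<bar>x $ i\<bar>) (mset_set K)"
    by (rule abs_roots_eq_if_prod_eq[of K "CARD('n) - 2 * card K"]) (simp_all flip: charpoly_normal_form add: charpoly)
  from image_mset_eq_implies_permutes[OF _ this]
  obtain \<rho> where \<rho>: "\<rho> permutes K" "\<And>i. i \<in> K \<Longrightarrow> \<bar>y $ i\<bar> = \<bar>x $ \<rho> i\<bar>"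
    using finite by metis
  define s where "s = (\<lambda>i. if y $ i = x $ \<rho> i then 1 else - 1 :: real)"
  have "y $ i = s i * x $ \<rho> i" for i
  proof (cases "i \<in> K")
    case True
    then show ?thesis
      using \<rho>(2)[of i] by (auto simp: s_def abs_eq_iff)
  next
    case False
    then show ?thesis
      using assms \<rho>(1) by (simp add: supported_def permutes_not_in)
  qed
  then have "y = signed_perm \<rho> s x"
    by (simp add: signed_perm_def vec_eq_iff)
  moreover have "signed_perm \<rho> s \<in> weyl"
  proof -
    have "\<forall>i. s i \<in> {1, - 1}"
      by (simp add: s_def)
    then show ?thesis
      unfolding weyl_def using \<rho>(1) by blast
  qed
  ultimately show thesis
    using that by blast
qed

end

section \<open>Faces of convex sets\<close>

text \<open>
  The smallest face through \<open>x\<close> works: a supporting hyperplane at a relative boundary point would cut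
  out a smaller one.
\<close>

lemma face_through_rel_interior:
  fixes S :: "'a::euclidean_space set"
  assumes "convex S" "x \<in> S"
  obtains T where "T face_of S" "x \<in> rel_interior T"
proof -
  define T where "T = \<Inter>{T. T face_of S \<and> x \<in> T}"
  have T: "T face_of S"
    unfolding T_def using assms by (intro face_of_Inter) (auto intro: face_of_refl)
  have xT: "x \<in> T"
    by (simp add: T_def)
  have convT: "convex T"
    using T by (rule face_of_imp_convex)
  have "x \<in> rel_interior T"
  proof (rule ccontr)
    assume "x \<notin> rel_interior T"
    then obtain a where ge: "\<And>y. y \<in> T \<Longrightarrow> a \<bullet> x \<le> a \<bullet> y"
      and less: "\<And>y. y \<in> rel_interior T \<Longrightarrow> a \<bullet> x < a \<bullet> y"
      using supporting_hyperplane_rel_boundary[OF convT xT] by metis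
    have "T \<inter> {y. a \<bullet> y = a \<bullet> x} face_of T"
      using convT ge by (rule face_of_Int_supporting_hyperplane_ge)
    then have "T \<inter> {y. a \<bullet> y = a \<bullet> x} face_of S"
      using T face_of_trans by blast
    then have "T \<subseteq> {y. a \<bullet> y = a \<bullet> x}"
      using xT unfolding T_def by blast
    moreover obtain y where "y \<in> rel_interior T"
      using xT convT rel_interior_eq_empty by blast
    ultimately show False
      using less[of y] rel_interior_subset by fastforce
  qed
  then show thesis
    using T that by blast
qed

lemma face_of_linear_vimage:
  assumes "linear f" "T face_of S'" "f ` S \<subseteq> S'" "convex S"
  shows "f -` T \<inter> S face_of S"
  unfolding face_of_def
proof (intro conjI ballI impI)
  show "f -` T \<inter> S \<subseteq> S"
    by blast
  show "convex (f -` T \<inter> S)"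
    using assms(1,4) face_of_imp_convex[OF assms(2)] by (intro convex_Int convex_linear_vimage)
  fix a b x
  assume a: "a \<in> S" and b: "b \<in> S" and x: "x \<in> f -` T \<inter> S" "x \<in> open_segment a b"
  have "f a \<in> T \<and> f b \<in> T"
  proof (cases "f a = f b")
    case True
    obtain u where "x = (1 - u) *\<^sub>R a + u *\<^sub>R b"
      using x(2) by (auto simp: in_segment)
    then have "f x = (1 - u) *\<^sub>R f a + u *\<^sub>R f b"
      using assms(1) by (simp add: linear_add linear_scale)
    then have "f x = f a"
      using True by (simp flip: scaleR_left_distrib)
    then show ?thesis
      using x True by simp
  next
    case False
    have "f x \<in> open_segment (f a) (f b)"
    proof -
      obtain u where u: "0 < u" "u < 1" "x = (1 - u) *\<^sub>R a + u *\<^sub>R b"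
        using x(2) by (auto simp: in_segment)
      then have "f x = (1 - u) *\<^sub>R f a + u *\<^sub>R f b"
        using assms(1) by (simp add: linear_add linear_scale)
      then show ?thesis
        using u False by (auto simp: in_segment)
    qed
    moreover have "f a \<in> S'" "f b \<in> S'" "f x \<in> T"
      using a b x assms(3) by auto
    ultimately show ?thesis
      using assms(2) unfolding face_of_def by blast
  qed
  then show "a \<in> f -` T \<inter> S" "b \<in> f -` T \<inter> S"
    using a b by auto
qed

text \<open>
  The minimum set of a linear functional is a face, and a face that meets the relative interior is
  everything.
\<close>

lemma linear_constant_on_if_min_rel_interior:
  fixes P :: "'a::euclidean_space set"
  assumes "convex P" "a \<in> rel_interior P" "\<And>x. x \<in> P \<Longrightarrow> z \<bullet> a \<le> z \<bullet> x" "x \<in> P"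
  shows "z \<bullet> x = z \<bullet> a"
proof -
  have "P \<inter> {x. z \<bullet> x = z \<bullet> a} face_of P"
    using assms by (intro face_of_Int_supporting_hyperplane_ge)
  moreover have "P \<inter> {x. z \<bullet> x = z \<bullet> a} \<inter> rel_interior P \<noteq> {}"
    using assms(2) rel_interior_subset by blast
  ultimately have "P \<subseteq> P \<inter> {x. z \<bullet> x = z \<bullet> a}"
    using subset_of_face_of by blast
  then show ?thesis
    using assms(4) by blast
qed

section \<open>The orbitope and the permutahedron\<close>

context index_pairing
begin

definition orbit :: "real^'n \<Rightarrow> (real^'n^'n) set" where
  "orbit p = {conj_act g (normal_form p) | g. orthogonal_matrix g}"

definition permutahedron :: "real^'n \<Rightarrow> (real^'n) set" where
  "permutahedron p = convex hull ((\<lambda>w. w p) ` weyl)"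

definition pullback :: "real^'n \<Rightarrow> (real^'n) set \<Rightarrow> (real^'n^'n) set" where
  "pullback p P = skew_diag -` P \<inter> convex hull (orbit p)"

lemma orbit_conj_act: "orthogonal_matrix g \<Longrightarrow> X \<in> orbit p \<Longrightarrow> conj_act g X \<in> orbit p"
  by (auto simp: orbit_def conj_act_mult intro: orthogonal_matrix_mul)

lemma orbitope_conj_act:
  assumes "orthogonal_matrix g"
  shows "conj_act g ` (convex hull (orbit p)) = convex hull (orbit p)"
proof -
  have "conj_act g ` orbit p = orbit p"
  proof
    show "orbit p \<subseteq> conj_act g ` orbit p"
      using assms orbit_conj_act[of "transpose g"]
      by (metis conj_act_inverse(2) image_eqI orthogonal_matrix_transpose subsetI)
  qed (use assms orbit_conj_act in auto)
  then show ?thesis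
    using linear_conj_act by (metis convex_hull_linear_image)
qed

lemma compact_orbit: "compact (orbit p)"
proof -
  have "orbit p = (\<lambda>g. conj_act g (normal_form p)) ` stabiliser {}"
    by (auto simp: orbit_def stabiliser_empty)
  then show ?thesis
    by (simp add: compact_continuous_image continuous_intros compact_stabiliser)
qed

lemma skew_orbit: "X \<in> orbit p \<Longrightarrow> skew_symmetric X"
  by (auto simp: orbit_def skew_conj_act skew_normal_form)

lemma skew_orbitope: "X \<in> convex hull (orbit p) \<Longrightarrow> skew_symmetric X"
proof -
  have "convex hull (orbit p) \<subseteq> {A. skew_symmetric A}"
    using subspace_skew subspace_imp_convex
    by (intro hull_minimal) (auto simp: skew_orbit)
  then show "X \<in> convex hull (orbit p) \<Longrightarrow> skew_symmetric X" by blast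
qed

lemma permutahedron_supported: "p \<in> supported \<Longrightarrow> permutahedron p \<subseteq> supported"
  unfolding permutahedron_def
  using weyl_supported subspace_supported subspace_imp_convex
  by (intro hull_minimal) auto

lemma finite_weyl: "finite weyl"
proof -
  have "weyl \<subseteq> (\<lambda>(\<rho>, s). signed_perm \<rho> s) ` ({\<rho>. \<rho> permutes K} \<times> {s. \<forall>i. s i \<in> {1, - 1}})"
    unfolding weyl_def by auto
  moreover have "finite {s :: 'n \<Rightarrow> real. \<forall>i. s i \<in> {1, - 1}}"
    using finite_PiE[of "UNIV :: 'n set" "\<lambda>_. {1, - 1 :: real}"]
    by (simp add: PiE_UNIV_domain Pi_def)
  ultimately show ?thesis
    by (meson finite finite_SigmaI finite_imageI finite_permutations finite_subset)
qed

lemma polytope_permutahedron: "polytope (permutahedron p)"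
  unfolding permutahedron_def by (intro polytope_convex_hull finite_imageI finite_weyl)

lemma weyl_permutahedron:
  assumes "w \<in> weyl" shows "w ` permutahedron p = permutahedron p"
proof -
  have "w ` (\<lambda>w. w p) ` weyl = (\<lambda>w. w p) ` weyl"
  proof
    show "w ` (\<lambda>w. w p) ` weyl \<subseteq> (\<lambda>w. w p) ` weyl"
    proof (intro subsetI, elim imageE, hypsubst)
      fix u assume "u \<in> weyl"
      then show "w (u p) \<in> (\<lambda>w. w p) ` weyl"
        using weyl_comp[OF assms] by (metis comp_apply image_eqI)
    qed
    obtain v where v: "v \<in> weyl" "w \<circ> v = id"
      using weyl_inverse[OF assms] by metis
    show "(\<lambda>w. w p) ` weyl \<subseteq> w ` (\<lambda>w. w p) ` weyl"
    proof
      fix x assume "x \<in> (\<lambda>w. w p) ` weyl"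
      then obtain u where u: "u \<in> weyl" "x = u p" by auto
      have "x = w ((v \<circ> u) p)"
        using v(2) u(2) by (metis comp_apply id_apply)
      then show "x \<in> w ` (\<lambda>w. w p) ` weyl"
        using weyl_comp[OF v(1) u(1)] by blast
    qed
  qed
  then show ?thesis
    unfolding permutahedron_def using linear_weyl[OF assms] by (metis convex_hull_linear_image)
qed

lemma normal_form_permutahedron: "normal_form ` permutahedron p \<subseteq> convex hull (orbit p)"
proof -
  have "normal_form (w p) \<in> orbit p" if "w \<in> weyl" for w
    using weyl_realised_by_conj_act[OF that] unfolding orbit_def by (metis (mono_tags, lifting) mem_Collect_eq)
  then have "convex hull (normal_form ` (\<lambda>w. w p) ` weyl) \<subseteq> convex hull (orbit p)"
    by (intro hull_mono) auto
  then show ?thesis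
    unfolding permutahedron_def by (simp add: convex_hull_linear_image linear_normal_form)
qed

lemma conj_act_normal_form_imp_weyl:
  assumes "x \<in> supported" "y \<in> supported" "orthogonal_matrix g" "conj_act g (normal_form x) = normal_form y"
  obtains w where "w \<in> weyl" "y = w x"
  using charpoly_eq_imp_weyl[OF assms(1,2)] charpoly_conj_act[OF assms(3), of _ "normal_form x"] assms(4) by metis

text \<open>
  A point of the orbit where the functional is maximal commutes with the normal form of \<open>y\<close>. The
  stabiliser of the latter moves it, without changing the value of the functional, to a normal form.
  This is the normal form of a signed permutation of \<open>p\<close>, where the bound is available.
\<close>

lemma inner_normal_form_le_on_orbit:
  assumes p: "p \<in> supported" and bound: "\<And>x. x \<in> permutahedron p \<Longrightarrow> y \<bullet> x \<le> b"
    and X: "X \<in> orbit p"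
  shows "normal_form y \<bullet> X \<le> 2 * b"
proof -
  have "orbit p \<noteq> {}" using X by auto
  moreover have "continuous_on (orbit p) (\<lambda>X. normal_form y \<bullet> X)"
    by (intro continuous_intros)
  ultimately obtain M where M: "M \<in> orbit p" and max: "\<And>X. X \<in> orbit p \<Longrightarrow> normal_form y \<bullet> X \<le> normal_form y \<bullet> M"
    using continuous_attains_sup[OF compact_orbit, of p "\<lambda>X. normal_form y \<bullet> X"] by blast
  have skewM: "skew_symmetric M"
    using M by (rule skew_orbit)
  have "M ** normal_form y = normal_form y ** M"
    by (rule commute_at_maximum[of _ "{}"])
      (use M max orbit_conj_act in \<open>auto simp: skew_commutant_empty stabiliser_empty skew_normal_form skewM inner_commute\<close>)
  then have "M \<in> skew_commutant {normal_form y}"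
    using skewM by (simp add: skew_commutant_def)
  then obtain h x where h: "h \<in> stabiliser {normal_form y}" and x: "x \<in> supported" "conj_act h M = normal_form x"
    using simultaneous_normal_form[of "{normal_form y}"] by auto
  obtain g where g: "orthogonal_matrix g" "M = conj_act g (normal_form p)"
    using M by (auto simp: orbit_def)
  have "conj_act (h ** g) (normal_form p) = normal_form x"
    using x g by (simp flip: conj_act_mult)
  then obtain w where w: "w \<in> weyl" "x = w p"
    using conj_act_normal_form_imp_weyl[OF p x(1)] orthogonal_matrix_mul[OF stabiliser_orthogonal[OF h] g(1)] by metis
  then have "x \<in> permutahedron p"
    by (simp add: permutahedron_def hull_inc)
  have "normal_form y \<bullet> M = conj_act (transpose h) (normal_form y) \<bullet> M"
    using conj_act_stabiliser[OF stabiliser_transpose[OF h]] by simp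
  also have "\<dots> = normal_form y \<bullet> normal_form x"
    using x(2) by (simp add: inner_conj_act)
  also have "\<dots> = 2 * (y \<bullet> x)"
    using x(1) by (simp add: inner_normal_form skew_normal_form skew_diag_normal_form)
  also have "\<dots> \<le> 2 * b"
    using bound[OF \<open>x \<in> permutahedron p\<close>] by simp
  finally show ?thesis
    using max[OF X] by simp
qed

text \<open>
  The analogue of Schur's theorem for the skew-diagonal. A separating linear functional would violate
  the bound that holds on the orbit.
\<close>

lemma skew_diag_orbitope:
  assumes p: "p \<in> supported"
  shows "skew_diag ` (convex hull (orbit p)) \<subseteq> permutahedron p"
proof -
  have "skew_diag X \<in> permutahedron p" if X: "X \<in> orbit p" for X
  proof (rule ccontr)
    assume "skew_diag X \<notin> permutahedron p"
    moreover have "convex (permutahedron p)" "closed (permutahedron p)"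
      using polytope_permutahedron polytope_imp_convex polytope_imp_closed by blast+
    ultimately obtain a b where a: "a \<bullet> skew_diag X < b" "\<And>x. x \<in> permutahedron p \<Longrightarrow> a \<bullet> x > b"
      using separating_hyperplane_closed_point by metis
    have "normal_form (- a) \<bullet> X \<le> 2 * (- b)"
      using p a(2) X by (intro inner_normal_form_le_on_orbit) (auto simp: less_imp_le)
    then have "- a \<bullet> skew_diag X \<le> - b"
      using inner_normal_form[OF skew_orbit[OF X], of "- a"] by simp
    then show False
      using a(1) by simp
  qed
  then have "convex hull (skew_diag ` orbit p) \<subseteq> permutahedron p"
    using polytope_permutahedron polytope_imp_convex by (intro hull_minimal) auto
  then show ?thesis
    by (simp add: convex_hull_linear_image linear_skew_diag)
qed

lemma pullback_face:
  assumes "p \<in> supported" "P face_of permutahedron p"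
  shows "pullback p P face_of convex hull (orbit p)"
  unfolding pullback_def
  by (rule face_of_linear_vimage[OF linear_skew_diag assms(2) skew_diag_orbitope[OF assms(1)] convex_convex_hull])

lemma skew_diag_pullback:
  assumes "p \<in> supported" "P face_of permutahedron p"
  shows "skew_diag ` pullback p P = P" "normal_form ` P \<subseteq> pullback p P"
proof -
  have P: "P \<subseteq> permutahedron p"
    using assms(2) by (rule face_of_imp_subset)
  have skew_diag: "skew_diag (normal_form x) = x" if "x \<in> P" for x
    using that P permutahedron_supported[OF assms(1)] by (auto simp: skew_diag_normal_form)
  show normal_form: "normal_form ` P \<subseteq> pullback p P"
    using P normal_form_permutahedron[of p] skew_diag by (auto simp: pullback_def)
  show "skew_diag ` pullback p P = P"
    using normal_form skew_diag by (force simp: pullback_def)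
qed

text \<open>
  Faces of a polytope are exposed, so \<open>P\<close> is the set of maximisers of some \<open>y\<close>, and its pullback is
  that of the inner product with the normal form of \<open>y\<close>. This set is visibly invariant under the stabiliser of that normal
  form. The pullback is the convex hull of points of the orbit, and these commute with the normal form
  of \<open>y\<close> since they are maximisers.
\<close>

lemma pullback_exposed:
  assumes p: "p \<in> supported" and P: "P face_of permutahedron p" "P \<noteq> {}"
  obtains y where "\<And>X. X \<in> pullback p P \<Longrightarrow> X \<in> skew_commutant {normal_form y}"
    "\<And>h. h \<in> stabiliser {normal_form y} \<Longrightarrow> conj_act h ` pullback p P = pullback p P"
proof -
  have "P exposed_face_of permutahedron p"
    using P polytope_permutahedron polytope_imp_polyhedron exposed_face_of_polyhedron by blast
  then obtain y b where le: "\<And>x. x \<in> permutahedron p \<Longrightarrow> y \<bullet> x \<le> b"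
    and eq: "P = permutahedron p \<inter> {x. y \<bullet> x = b}"
    unfolding exposed_face_of_def by blast
  have G: "pullback p P = convex hull (orbit p) \<inter> {X. normal_form y \<bullet> X = 2 * b}"
    using skew_diag_orbitope[OF p] by (auto simp: pullback_def eq inner_normal_form skew_orbitope)
  have inv: "conj_act h X \<in> pullback p P" if "h \<in> stabiliser {normal_form y}" "X \<in> pullback p P" for h X
  proof -
    have "normal_form y \<bullet> conj_act h X = conj_act h X \<bullet> normal_form y"
      by (rule inner_commute)
    also have "\<dots> = X \<bullet> normal_form y"
      using conj_act_stabiliser[OF stabiliser_transpose[OF that(1)]] by (simp add: inner_conj_act)
    finally show ?thesis
      using that orbitope_conj_act[OF stabiliser_orthogonal[OF that(1)], of p]
      by (auto simp: G inner_commute)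
  qed
  have "conj_act h ` pullback p P = pullback p P" if h: "h \<in> stabiliser {normal_form y}" for h
  proof
    show "pullback p P \<subseteq> conj_act h ` pullback p P"
      using inv[OF stabiliser_transpose[OF h]] conj_act_inverse(2)[OF stabiliser_orthogonal[OF h]]
      by (metis image_eqI subsetI)
  qed (use inv[OF h] in auto)
  moreover have "pullback p P \<subseteq> skew_commutant {normal_form y}"
  proof -
    obtain S where S: "S \<subseteq> orbit p" "pullback p P = convex hull S"
      using face_of_convex_hull_subset[OF compact_orbit pullback_face[OF p P(1)]] by metis
    have "X \<in> skew_commutant {normal_form y}" if "X \<in> S" for X
    proof -
      have X: "X \<in> orbit p" "normal_form y \<bullet> X = 2 * b"
        using that S hull_subset[of S convex] G by auto
      have skewX: "skew_symmetric X"
        using X(1) by (rule skew_orbit)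
      have "conj_act h X \<bullet> normal_form y \<le> X \<bullet> normal_form y" if "orthogonal_matrix h" for h
        using inner_normal_form_le_on_orbit[OF p le orbit_conj_act[OF that X(1)]] X(2) by (simp add: inner_commute)
      then have "X ** normal_form y = normal_form y ** X"
        by (intro commute_at_maximum[of _ "{}"])
          (auto simp: skew_commutant_empty stabiliser_empty skew_normal_form skewX)
      then show ?thesis
        using skewX by (simp add: skew_commutant_def)
    qed
    then show ?thesis
      unfolding S(2) using subspace_skew_commutant subspace_imp_convex by (intro hull_minimal) auto
  qed
  ultimately show thesis
    using that[of y] by blast
qed

text \<open>
  The heart of the proof: nothing of the pullback of \<open>P\<close> sticks out beyond the minimal face through
  the normal form of \<open>a\<close>. A functional \<open>Z\<close> that supports the pullback at this point is turned into
  a normal form without losing that property, and is then controlled by its restriction to \<open>P\<close>.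
\<close>

lemma rel_interior_pullback:
  assumes p: "p \<in> supported" and P: "P face_of permutahedron p" and a: "a \<in> rel_interior P"
  shows "normal_form a \<in> rel_interior (pullback p P)"
proof (rule ccontr)
  assume "normal_form a \<notin> rel_interior (pullback p P)"
  define G where "G = pullback p P"
  have aP: "a \<in> P"
    using a rel_interior_subset by blast
  then obtain y where comm: "\<And>X. X \<in> G \<Longrightarrow> X \<in> skew_commutant {normal_form y}"
    and inv: "\<And>h. h \<in> stabiliser {normal_form y} \<Longrightarrow> conj_act h ` G = G"
    using pullback_exposed[OF p P] unfolding G_def by blast
  have convG: "convex G"
    using pullback_face[OF p P] face_of_imp_convex unfolding G_def by blast
  have aG: "normal_form a \<in> G"
    using skew_diag_pullback(2)[OF p P] aP unfolding G_def by blast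
  obtain Z0 where le0: "\<And>X. X \<in> G \<Longrightarrow> Z0 \<bullet> normal_form a \<le> Z0 \<bullet> X"
    and less0: "\<And>X. X \<in> rel_interior G \<Longrightarrow> Z0 \<bullet> normal_form a < Z0 \<bullet> X"
    using supporting_hyperplane_rel_boundary[OF convG aG] \<open>normal_form a \<notin> _\<close> unfolding G_def by metis
  \<comment> \<open>Discarding the component \<open>Z'\<close> orthogonal to the commutant changes nothing on \<open>G\<close>.\<close>
  obtain Z Z' where Z: "Z \<in> span (skew_commutant {normal_form y})"
    and Z': "\<And>X. X \<in> span (skew_commutant {normal_form y}) \<Longrightarrow> orthogonal Z' X" and "Z0 = Z + Z'"
    using orthogonal_subspace_decomp_exists by metis
  have span: "span (skew_commutant {normal_form y}) = skew_commutant {normal_form y}"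
    using subspace_skew_commutant span_eq_iff by blast
  have Z0: "Z0 \<bullet> X = Z \<bullet> X" if "X \<in> G" for X
    using Z'[of X] comm[OF that] \<open>Z0 = Z + Z'\<close> span by (simp add: orthogonal_def inner_add_left)
  have le: "\<And>X. X \<in> G \<Longrightarrow> Z \<bullet> normal_form a \<le> Z \<bullet> X"
    and less: "\<And>X. X \<in> rel_interior G \<Longrightarrow> Z \<bullet> normal_form a < Z \<bullet> X"
    using le0 less0 Z0 aG rel_interior_subset by (metis, metis subsetD)
  have Zcomm: "Z \<in> skew_commutant {normal_form y}"
    using Z span by simp
  have "normal_form a ** (- Z) = - Z ** normal_form a"
  proof (rule commute_at_maximum)
    show "normal_form a \<in> skew_commutant {normal_form y}" "- Z \<in> skew_commutant {normal_form y}"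
      using comm aG Zcomm subspace_neg[OF subspace_skew_commutant] by blast+
    fix h assume "h \<in> stabiliser {normal_form y}"
    then have "conj_act h (normal_form a) \<in> G"
      using inv aG by blast
    then show "conj_act h (normal_form a) \<bullet> - Z \<le> normal_form a \<bullet> - Z"
      using le[of "conj_act h (normal_form a)"] by (simp add: inner_commute)
  qed
  then have "Z ** normal_form a = normal_form a ** Z"
    by (simp add: matrix_mult_uminus matrix_uminus_mult)
  then have "Z \<in> skew_commutant {normal_form y, normal_form a}"
    using Zcomm by (simp add: skew_commutant_def)
  then obtain h z where h: "h \<in> stabiliser {normal_form y, normal_form a}" and z: "conj_act h Z = normal_form z"
    using simultaneous_normal_form[of "{normal_form y, normal_form a}" Z]
    by (metis empty_subsetI insert_subset rangeI)
  have hy: "h \<in> stabiliser {normal_form y}"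
    using h by (simp add: stabiliser_def)
  have Z_eq: "Z \<bullet> X = 2 * (z \<bullet> skew_diag (conj_act h X))" if "X \<in> G" for X
  proof -
    have "Z \<bullet> X = conj_act (transpose h) (normal_form z) \<bullet> X"
      using conj_act_inverse(1)[OF stabiliser_orthogonal[OF h], of Z] z by simp
    also have "\<dots> = normal_form z \<bullet> conj_act h X"
      by (simp add: inner_conj_act)
    also have "\<dots> = 2 * (z \<bullet> skew_diag (conj_act h X))"
      using comm[OF that] by (intro inner_normal_form skew_conj_act) (simp add: skew_commutant_def)
    finally show ?thesis .
  qed
  have skew_diag_a: "skew_diag (normal_form a) = a"
    using aP face_of_imp_subset[OF P] permutahedron_supported[OF p] by (intro skew_diag_normal_form) auto
  have Za: "Z \<bullet> normal_form a = 2 * (z \<bullet> a)"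
    using Z_eq[OF aG] conj_act_stabiliser[OF h, of "normal_form a"] skew_diag_a by simp
  have "z \<bullet> a \<le> z \<bullet> x" if "x \<in> P" for x
  proof -
    have "x \<in> skew_diag ` conj_act h ` G"
      using inv[OF hy] skew_diag_pullback(1)[OF p P] that by (simp add: G_def)
    then obtain X where "X \<in> G" "x = skew_diag (conj_act h X)" by auto
    then show ?thesis
      using le[of X] Z_eq[of X] Za by simp
  qed
  then have const: "z \<bullet> x = z \<bullet> a" if "x \<in> P" for x
    using linear_constant_on_if_min_rel_interior[OF face_of_imp_convex[OF P] a] that by blast
  obtain X where X: "X \<in> rel_interior G"
    using convG aG rel_interior_eq_empty by blast
  then have "X \<in> G"
    using rel_interior_subset by blast
  then have "skew_diag (conj_act h X) \<in> P"
    using inv[OF hy] by (auto simp: G_def pullback_def)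
  then have "Z \<bullet> X = Z \<bullet> normal_form a"
    using Z_eq[OF \<open>X \<in> G\<close>] Za const by simp
  then show False
    using less[OF X] by simp
qed

lemma face_orbit_contains_pullback:
  assumes p: "p \<in> supported" and F: "F face_of convex hull (orbit p)" "F \<noteq> {}"
  obtains g P where "orthogonal_matrix g" "P face_of permutahedron p" "conj_act g ` F = pullback p P"
proof -
  have convF: "convex F"
    using F(1) by (rule face_of_imp_convex)
  obtain A where A: "A \<in> rel_interior F"
    using F(2) convF rel_interior_eq_empty by blast
  then have "A \<in> convex hull (orbit p)"
    using F(1) rel_interior_subset face_of_imp_subset by blast
  then have "A \<in> skew_commutant {}"
    by (simp add: skew_commutant_empty skew_orbitope)
  then obtain g a where g: "orthogonal_matrix g" and a: "a \<in> supported" "conj_act g A = normal_form a"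
    using simultaneous_normal_form[of "{}"] by (auto simp: stabiliser_empty)
  have "conj_act g ` F face_of conj_act g ` (convex hull (orbit p))"
    using F(1) by (simp add: face_of_linear_image linear_conj_act inj_conj_act[OF g])
  then have gF: "conj_act g ` F face_of convex hull (orbit p)"
    by (simp add: orbitope_conj_act[OF g])
  have relF: "normal_form a \<in> rel_interior (conj_act g ` F)"
    using A a(2) rel_interior_convex_linear_image[OF linear_conj_act convF, of g] by force
  then have "normal_form a \<in> convex hull (orbit p)"
    using gF face_of_imp_subset rel_interior_subset by blast
  then have "a \<in> permutahedron p"
    using skew_diag_orbitope[OF p] skew_diag_normal_form[OF a(1)] by force
  then obtain P where P: "P face_of permutahedron p" "a \<in> rel_interior P"
    using face_through_rel_interior polytope_imp_convex[OF polytope_permutahedron] by metis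
  have "conj_act g ` F = pullback p P"
    using face_of_eq[OF gF pullback_face[OF p P(1)]] relF rel_interior_pullback[OF p P] by blast
  then show thesis
    using that g P(1) by blast
qed

text \<open>
  A relative interior point of \<open>P\<close> is followed through the conjugation by \<open>g\<close> and then back to a
  normal form by the stabiliser of the pullback of \<open>Q\<close>.
\<close>

lemma pullback_conj_weyl:
  assumes p: "p \<in> supported" and P: "P face_of permutahedron p" "P \<noteq> {}"
    and Q: "Q face_of permutahedron p" and g: "orthogonal_matrix g"
    and eq: "conj_act g ` pullback p P = pullback p Q"
  obtains w where "w \<in> weyl" "Q = w ` P"
proof -
  have conv: "convex P" "convex (pullback p P)" "convex (pullback p Q)"
    using P Q pullback_face[OF p] face_of_imp_convex by blast+
  obtain a where a: "a \<in> rel_interior P"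
    using P(2) conv(1) rel_interior_eq_empty by blast
  then have "a \<in> permutahedron p"
    using P(1) rel_interior_subset face_of_imp_subset by blast
  then have a_supp: "a \<in> supported"
    using permutahedron_supported[OF p] by blast
  define Y where "Y = conj_act g (normal_form a)"
  have Y: "Y \<in> rel_interior (pullback p Q)"
    unfolding Y_def eq[symmetric] rel_interior_convex_linear_image[OF linear_conj_act conv(2), symmetric]
    using rel_interior_pullback[OF p P(1) a] by blast
  then have YQ: "Y \<in> pullback p Q"
    using rel_interior_subset by blast
  then have "Q \<noteq> {}"
    by (auto simp: pullback_def)
  then obtain y where comm: "\<And>X. X \<in> pullback p Q \<Longrightarrow> X \<in> skew_commutant {normal_form y}"
    and inv: "\<And>h. h \<in> stabiliser {normal_form y} \<Longrightarrow> conj_act h ` pullback p Q = pullback p Q"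
    using pullback_exposed[OF p Q] by blast
  obtain h b where h: "h \<in> stabiliser {normal_form y}" and b: "b \<in> supported" "conj_act h Y = normal_form b"
    using simultaneous_normal_form[of "{normal_form y}"] comm[OF YQ] by auto
  have "normal_form b \<in> rel_interior (conj_act h ` pullback p Q)"
    unfolding b(2)[symmetric] rel_interior_convex_linear_image[OF linear_conj_act conv(3), symmetric]
    using Y by blast
  then have "skew_diag (normal_form b) \<in> rel_interior (skew_diag ` pullback p Q)"
    unfolding rel_interior_convex_linear_image[OF linear_skew_diag conv(3), symmetric] inv[OF h] by blast
  then have bQ: "b \<in> rel_interior Q"
    by (simp add: skew_diag_pullback(1)[OF p Q] skew_diag_normal_form b(1))
  have "conj_act (h ** g) (normal_form a) = normal_form b"
    using b(2) by (simp add: Y_def conj_act_mult)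
  then obtain w where w: "w \<in> weyl" "b = w a"
    using conj_act_normal_form_imp_weyl[OF a_supp b(1)] orthogonal_matrix_mul[OF stabiliser_orthogonal[OF h] g] by metis
  obtain v where "v \<circ> w = id"
    using weyl_inverse[OF w(1)] by metis
  then have "inj w"
    by (metis inj_on_id inj_on_imageI2)
  then have "w ` P face_of w ` permutahedron p"
    using P(1) linear_weyl[OF w(1)] by (simp add: face_of_linear_image)
  then have "w ` P face_of permutahedron p"
    by (simp add: weyl_permutahedron[OF w(1)])
  moreover have "b \<in> rel_interior (w ` P)"
    unfolding w(2) rel_interior_convex_linear_image[OF linear_weyl[OF w(1)] conv(1), symmetric]
    using a by blast
  ultimately have "Q = w ` P"
    using face_of_eq[OF Q] bQ by blast
  then show thesis
    using that w(1) by blast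
qed

end

section \<open>Positions given by an enumeration\<close>

text \<open>
  The \<open>j\<close>-th row of the upper right block has its skew-diagonal entry in column \<open>n - k + j\<close>. These two
  positions are exchanged, and the middle position is fixed.
\<close>

definition partner :: "(nat \<Rightarrow> 'n::finite) \<Rightarrow> 'n \<Rightarrow> 'n" where
  "partner e i = (let n = CARD('n); k = half_dim TYPE('n); j = inv_into {1..n} e i
     in e (if j \<le> k then n - k + j else if n - k < j then j - (n - k) else j))"

text \<open>
  The number \<open>k\<close> is a parameter because a constant that depends only on the index type would have to
  take that type as an argument.
\<close>

locale enumeration =
  fixes e :: "nat \<Rightarrow> 'n::finite" and k :: nat
  assumes bij: "bij_betw e {1..CARD('n)} UNIV"
    and k_def: "half_dim TYPE('n) = k"
begin

definition pos :: "'n \<Rightarrow> nat" where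
  "pos = inv_into {1..CARD('n)} e"

definition upper :: "'n set" where
  "upper = e ` {1..k}"

lemma k_le: "2 * k \<le> CARD('n)" "k \<le> CARD('n)" "CARD('n) - 2 * k = CARD('n) mod 2"
  and k_cases: "CARD('n) = 2 * k \<or> CARD('n) = 2 * k + 1"
  using k_def unfolding half_dim_def by presburger+

lemma pos_e: "j \<in> {1..CARD('n)} \<Longrightarrow> pos (e j) = j"
  using bij by (simp add: bij_betw_def pos_def)

lemma e_pos: "e (pos i) = i"
  using bij unfolding pos_def by (metis UNIV_I bij_betw_def f_inv_into_f)

lemma pos_range: "1 \<le> pos i" "pos i \<le> CARD('n)"
  using inv_into_into[of i e "{1..CARD('n)}"] bij by (auto simp: bij_betw_def pos_def)

lemma upper_iff: "i \<in> upper \<longleftrightarrow> pos i \<le> k"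
proof
  assume "pos i \<le> k"
  then show "i \<in> upper"
    using pos_range(1)[of i] e_pos[of i] unfolding upper_def by (metis atLeastAtMost_iff image_eqI)
qed (use k_le pos_e in \<open>auto simp: upper_def\<close>)

lemma pos_partner: "pos (partner e i) =
    (if pos i \<le> k then CARD('n) - k + pos i
     else if CARD('n) - k < pos i then pos i - (CARD('n) - k) else pos i)"
  unfolding partner_def Let_def k_def pos_def[symmetric]
  using k_le pos_range[of i] by (intro pos_e) auto

sublocale index_pairing "upper" "partner e"
proof
  show "partner e (partner e i) = i" for i
  proof -
    have "pos (partner e (partner e i)) = pos i"
      using k_cases pos_range[of i] by (auto simp: pos_partner)
    then show ?thesis
      by (metis e_pos)
  qed
  show "partner e i \<notin> upper" if "i \<in> upper" for i
    using that k_cases pos_range[of i] by (auto simp: upper_iff pos_partner)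
  show "i = l" if "i \<notin> upper" "partner e i \<notin> upper"
    "l \<notin> upper" "partner e l \<notin> upper" for i l
  proof -
    have "pos i = pos l"
      using that k_cases pos_range[of i] pos_range[of l]
      by (auto simp: upper_iff pos_partner split: if_splits)
    then show ?thesis
      by (metis e_pos)
  qed
qed

lemma card_upper: "card upper = k"
proof -
  have "inj_on e {1..k}"
    using bij k_le by (auto simp: bij_betw_def intro: inj_on_subset)
  then show ?thesis
    by (simp add: upper_def card_image)
qed

lemma tuple_nth: "tuple e f $ i = (if pos i \<le> k then f (pos i) else 0)"
  unfolding tuple_def Let_def k_def pos_def[symmetric] by simp

lemma tuple_supported: "tuple e f \<in> supported"
  by (simp add: supported_def upper_iff tuple_nth)

lemma supported_tuple: "x \<in> supported \<Longrightarrow> x = tuple e (\<lambda>j. x $ e j)"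
  by (simp add: vec_eq_iff tuple_nth e_pos supported_def upper_iff)

lemma SD_eq_skew_diag: "SD e A = skew_diag A"
proof -
  have "e (CARD('n) - k + pos i) = partner e i" if "pos i \<le> k" for i
    using that unfolding partner_def Let_def k_def pos_def[symmetric] by simp
  then show ?thesis
    by (simp add: vec_eq_iff SD_def k_def tuple_nth skew_diag_def upper_iff e_pos)
qed

text \<open>
  The two groups consist of different maps, since \<open>signed_perms\<close> sends all other coordinates to zero,
  but their restrictions to \<open>\<real>\<^sup>k\<close> are the same. The map \<open>v\<close> is arbitrary so that an element of either
  group can be inserted.
\<close>

lemma signed_perms_weyl:
  "(\<exists>w\<in>signed_perms e. \<forall>x\<in>supported. w x = v x) \<longleftrightarrow> (\<exists>w\<in>weyl. \<forall>x\<in>supported. w x = v x)"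
proof
  assume "\<exists>w\<in>signed_perms e. \<forall>x\<in>supported. w x = v x"
  then obtain \<pi> s where \<pi>: "\<pi> permutes {1..k}" and s: "\<forall>j. s j \<in> {1, - 1 :: real}"
    and v: "\<And>x. x \<in> supported \<Longrightarrow> v x = tuple e (\<lambda>j. s j * x $ e (\<pi> j))"
    unfolding signed_perms_def k_def by fastforce
  have bijK: "bij_betw e {1..k} upper"
    using bij k_le by (auto simp: upper_def bij_betw_def intro: inj_on_subset)
  define \<rho> where "\<rho> = (\<lambda>i. if i \<in> upper then e (\<pi> (inv_into {1..k} e i)) else i)"
  have \<rho>: "\<rho> permutes upper"
    unfolding \<rho>_def by (rule permutes_bij_inv_into[OF \<pi> bijK])
  have \<rho>_eq: "\<rho> i = e (\<pi> (pos i))" if "pos i \<le> k" for i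
  proof -
    have "inv_into {1..k} e i = pos i"
      using that pos_range(1)[of i] e_pos[of i] bijK
      by (metis atLeastAtMost_iff bij_betw_inv_into_left)
    then show ?thesis
      using that by (simp only: \<rho>_def upper_iff if_True)
  qed
  have "signed_perm \<rho> (\<lambda>i. s (pos i)) x = v x" if x: "x \<in> supported" for x
  proof -
    have "signed_perm \<rho> (\<lambda>i. s (pos i)) x $ i = v x $ i" for i
      using x permutes_not_in[OF \<rho>, of i]
      by (cases "pos i \<le> k")
        (simp_all add: v signed_perm_def tuple_nth \<rho>_eq supported_def upper_iff)
    then show ?thesis
      by (simp add: vec_eq_iff)
  qed
  moreover have "signed_perm \<rho> (\<lambda>i. s (pos i)) \<in> weyl"
    unfolding weyl_def using \<rho> s by blast
  ultimately show "\<exists>w\<in>weyl. \<forall>x\<in>supported. w x = v x"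
    by blast
next
  assume "\<exists>w\<in>weyl. \<forall>x\<in>supported. w x = v x"
  then obtain \<rho> s where \<rho>: "\<rho> permutes upper" and s: "\<forall>i. s i \<in> {1, - 1 :: real}"
    and v: "\<And>x. x \<in> supported \<Longrightarrow> v x = signed_perm \<rho> s x"
    unfolding weyl_def by fastforce
  have bijK: "bij_betw pos upper {1..k}"
    by (rule bij_betw_byWitness[of _ e]) (use pos_e k_le e_pos pos_range upper_iff in \<open>auto simp: upper_def\<close>)
  have inv: "inv_into upper pos j = e j" if "j \<in> {1..k}" for j
    using that bijK pos_e k_le by (intro inv_into_f_eq) (auto simp: bij_betw_def upper_def)
  define \<pi> where "\<pi> = (\<lambda>j. if j \<in> {1..k} then pos (\<rho> (inv_into upper pos j)) else j)"
  have \<pi>: "\<pi> permutes {1..k}"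
    unfolding \<pi>_def by (rule permutes_bij_inv_into[OF \<rho> bijK])
  have "tuple e (\<lambda>j. s (e j) * x $ e (\<pi> j)) = v x" if x: "x \<in> supported" for x
  proof -
    have "tuple e (\<lambda>j. s (e j) * x $ e (\<pi> j)) $ i = signed_perm \<rho> s x $ i" for i
    proof (cases "pos i \<le> k")
      case True
      then show ?thesis
        using pos_range(1)[of i] by (simp add: tuple_nth signed_perm_def \<pi>_def inv e_pos)
    next
      case False
      then show ?thesis
        using x \<rho> by (simp add: tuple_nth signed_perm_def permutes_not_in upper_iff supported_def)
    qed
    then show ?thesis
      by (simp add: v[OF x] vec_eq_iff)
  qed
  moreover have "(\<lambda>x. tuple e (\<lambda>j. s (e j) * x $ e (\<pi> j))) \<in> signed_perms e"
    unfolding signed_perms_def k_def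
    by (intro CollectI exI[of _ \<pi>] exI[of _ "\<lambda>j. s (e j)"] conjI refl) (use \<pi> s in simp_all)
  ultimately show "\<exists>w\<in>signed_perms e. \<forall>x\<in>supported. w x = v x"
    by (intro bexI[of _ "\<lambda>x. tuple e (\<lambda>j. s (e j) * x $ e (\<pi> j))"] ballI)
qed

lemma B_permutahedron_eq:
  assumes "p \<in> supported" shows "B_permutahedron e p = permutahedron p"
proof -
  have "{w p | w. w \<in> signed_perms e} = (\<lambda>w. w p) ` weyl"
    using signed_perms_weyl assms by (auto simp: image_iff) (metis, metis)
  then show ?thesis
    by (simp add: B_permutahedron_def permutahedron_def)
qed

lemma B_orbit_eq:
  assumes "P \<subseteq> supported" shows "B_orbit e P = (\<lambda>w. w ` P) ` weyl"
proof (intro equalityI subsetI)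
  fix Q assume "Q \<in> B_orbit e P"
  then obtain w where "w \<in> signed_perms e" "Q = w ` P"
    by (auto simp: B_orbit_def)
  moreover then obtain v where "v \<in> weyl" "\<forall>x\<in>supported. v x = w x"
    using signed_perms_weyl[of w] by blast
  ultimately show "Q \<in> (\<lambda>w. w ` P) ` weyl"
    using assms by (metis (no_types, lifting) image_cong image_eqI subsetD)
next
  fix Q assume "Q \<in> (\<lambda>w. w ` P) ` weyl"
  then obtain w where "w \<in> weyl" "Q = w ` P"
    by auto
  moreover then obtain v where "v \<in> signed_perms e" "\<forall>x\<in>supported. v x = w x"
    using signed_perms_weyl[of w] by blast
  moreover then have "v ` P = w ` P"
    using assms by (intro image_cong) auto
  ultimately show "Q \<in> B_orbit e P"
    unfolding B_orbit_def by blast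
qed

lemma charpoly_tuple:
  "det (mat z - complexify (normal_form (tuple e l))) = z ^ (CARD('n) mod 2) *
     (\<Prod>j = 1..k. (z - \<i> * complex_of_real (l j)) * (z + \<i> * complex_of_real (l j)))"
proof -
  have inj: "inj_on e {1..k}"
    using bij k_le by (auto simp: bij_betw_def intro: inj_on_subset)
  have "(\<Prod>i\<in>upper. (z - \<i> * complex_of_real (tuple e l $ i)) * (z + \<i> * complex_of_real (tuple e l $ i))) =
      (\<Prod>j = 1..k. (z - \<i> * complex_of_real (l j)) * (z + \<i> * complex_of_real (l j)))"
    unfolding upper_def prod.reindex[OF inj] comp_def using pos_e k_le
    by (intro prod.cong refl) (auto simp: tuple_nth)
  then show ?thesis
    by (simp add: charpoly_normal_form card_upper k_le)
qed

lemma normal_form_exists: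
  assumes "skew_symmetric N"
  obtains g x where "orthogonal_matrix g" "x \<in> supported" "conj_act g N = normal_form x"
    "\<And>z. det (mat z - complexify N) = det (mat z - complexify (normal_form x))"
proof -
  obtain g x where g: "orthogonal_matrix g" "x \<in> supported" "conj_act g N = normal_form x"
    using simultaneous_normal_form[of "{}" N] assms
    by (auto simp: stabiliser_empty skew_commutant_empty)
  then show thesis
    using that charpoly_conj_act[OF g(1), of _ N] by metis
qed

definition dominant :: "(nat \<Rightarrow> real) \<Rightarrow> bool" where
  "dominant l \<longleftrightarrow> (\<forall>j\<in>{1..k}. 0 \<le> l j) \<and> (\<forall>j\<in>{1..k}. \<forall>j'\<in>{1..k}. j \<le> j' \<longrightarrow> l j' \<le> l j)"

lemma mset_map_upt: "mset (map f [1..<Suc k]) = image_mset f (mset_set {1..k})"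
  by (simp add: atLeastLessThanSuc_atLeastAtMost del: upt_Suc)

text \<open>
  A decreasing nonnegative tuple is the sorted list of the absolute values of its entries, which the
  characteristic polynomial determines.
\<close>

lemma dominant_unique:
  assumes l: "dominant l" and m: "dominant m"
    and eq: "\<And>z. det (mat z - complexify (normal_form (tuple e l))) = det (mat z - complexify (normal_form (tuple e m)))"
  shows "tuple e l = tuple e m"
proof -
  have "image_mset (\<lambda>j. \<bar>l j\<bar>) (mset_set {1..k}) = image_mset (\<lambda>j. \<bar>m j\<bar>) (mset_set {1..k})"
    by (rule abs_roots_eq_if_prod_eq[of _ "CARD('n) mod 2"]) (use eq in \<open>simp_all only: charpoly_tuple finite_atLeastAtMost\<close>)
  moreover have "image_mset (\<lambda>j. \<bar>l j\<bar>) (mset_set {1..k}) = image_mset l (mset_set {1..k})"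
    and "image_mset (\<lambda>j. \<bar>m j\<bar>) (mset_set {1..k}) = image_mset m (mset_set {1..k})"
    using l m by (auto intro!: image_mset_cong simp: dominant_def)
  ultimately have "image_mset uminus (image_mset l (mset_set {1..k})) =
      image_mset uminus (image_mset m (mset_set {1..k}))"
    by simp
  then have "mset (map (\<lambda>j. - l j) [1..<Suc k]) = mset (map (\<lambda>j. - m j) [1..<Suc k])"
    unfolding mset_map_upt by (simp add: multiset.map_comp comp_def)
  moreover have "sorted (map (\<lambda>j. - f j) [1..<Suc k])" if "dominant f" for f
    using that by (auto simp: sorted_iff_nth_mono dominant_def simp del: upt_Suc)
  ultimately have "map (\<lambda>j. - l j) [1..<Suc k] = map (\<lambda>j. - m j) [1..<Suc k]"
    using l m properties_for_sort by metis
  then have "l j = m j" if "j \<in> {1..k}" for j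
    using that by (simp add: map_eq_conv del: upt_Suc)
  then show ?thesis
    using pos_range by (simp add: vec_eq_iff tuple_nth)
qed

lemma dominant_exists:
  obtains m where "dominant m"
    "\<And>z. det (mat z - complexify (normal_form (tuple e l))) = det (mat z - complexify (normal_form (tuple e m)))"
proof -
  \<comment> \<open>Sorting is increasing, so the negatives of the absolute values are sorted.\<close>
  define xs where "xs = sort (map (\<lambda>j. - \<bar>l j\<bar>) [1..<Suc k])"
  have len: "length xs = k"
    by (simp add: xs_def)
  define m where "m = (\<lambda>j. - xs ! (j - 1))"
  have "map (\<lambda>j. - m j) [1..<Suc k] = xs"
    by (rule nth_equalityI) (simp_all add: len m_def del: upt_Suc)
  then have "image_mset (\<lambda>j. - m j) (mset_set {1..k}) = image_mset (\<lambda>j. - \<bar>l j\<bar>) (mset_set {1..k})"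
    unfolding mset_map_upt[symmetric] by (simp add: xs_def del: upt_Suc)
  from image_mset_eq_implies_permutes[OF finite_atLeastAtMost this]
  obtain \<pi> where \<pi>: "\<pi> permutes {1..k}" and neg: "\<forall>j\<in>{1..k}. - m j = - \<bar>l (\<pi> j)\<bar>" .
  have eq: "m j = \<bar>l (\<pi> j)\<bar>" if "j \<in> {1..k}" for j
    using bspec[OF neg that] by simp
  have "dominant m"
    unfolding dominant_def
  proof (intro conjI ballI impI)
    show "0 \<le> m j" if "j \<in> {1..k}" for j
      by (simp add: eq[OF that])
    show "m j' \<le> m j" if "j \<in> {1..k}" "j' \<in> {1..k}" "j \<le> j'" for j j'
      using that sorted_nth_mono[of xs "j - 1" "j' - 1"] by (auto simp: m_def len xs_def)
  qed
  moreover have "det (mat z - complexify (normal_form (tuple e l))) = det (mat z - complexify (normal_form (tuple e m)))" for z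
  proof -
    define f where "f = (\<lambda>a. (z - \<i> * complex_of_real a) * (z + \<i> * complex_of_real a))"
    have "f (m j) = f (l (\<pi> j))" if "j \<in> {1..k}" for j
      by (simp add: eq[OF that] f_def abs_if algebra_simps)
    then have "(\<Prod>j = 1..k. f (m j)) = (\<Prod>j = 1..k. f (l (\<pi> j)))"
      by (intro prod.cong refl)
    also have "\<dots> = (\<Prod>j = 1..k. f (l j))"
      using prod.permute[OF \<pi>, of "\<lambda>j. f (l j)"] by (simp add: comp_def)
    finally show ?thesis
      by (simp add: charpoly_tuple f_def)
  qed
  ultimately show thesis
    by (rule that)
qed

text \<open>
  The definite description denotes a tuple of the expected kind: the absolute values of the entries
  of any normal form of \<open>N\<close> can be sorted, and the sorted tuple is unique.
\<close>

lemma skew_eigenvalues: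
  assumes "skew_symmetric N"
  shows "skew_eigenvalues e N \<in> supported"
    and "det (mat z - complexify N) = det (mat z - complexify (normal_form (skew_eigenvalues e N)))"
proof -
  define good where "good = (\<lambda>p. \<exists>l. p = tuple e l \<and> dominant l \<and>
    (\<forall>z. det (mat z - complexify N) = det (mat z - complexify (normal_form (tuple e l)))))"
  obtain x where x: "x \<in> supported" "\<And>z. det (mat z - complexify N) = det (mat z - complexify (normal_form x))"
    using normal_form_exists[OF assms] by metis
  obtain m where "dominant m" "\<And>z. det (mat z - complexify (normal_form x)) = det (mat z - complexify (normal_form (tuple e m)))"
    using dominant_exists[of "\<lambda>j. x $ e j"] supported_tuple[OF x(1)] by metis
  then have "good (tuple e m)"
    using x(2) by (auto simp: good_def)
  moreover have "p = q" if "good p" "good q" for p q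
    using that dominant_unique unfolding good_def by metis
  ultimately have "good (THE p. good p)"
    by (metis theI)
  moreover have "skew_eigenvalues e N = (THE p. good p)"
    unfolding skew_eigenvalues_def k_def good_def dominant_def charpoly_tuple by (simp add: conj_assoc)
  ultimately have "good (skew_eigenvalues e N)"
    by simp
  then show "skew_eigenvalues e N \<in> supported"
    and "det (mat z - complexify N) = det (mat z - complexify (normal_form (skew_eigenvalues e N)))"
    using tuple_supported by (auto simp: good_def)
qed

lemma orbitope_eq:
  assumes "skew_symmetric N"
  shows "orbitope N = convex hull (orbit (skew_eigenvalues e N))"
proof -
  obtain g x where g: "orthogonal_matrix g" and x: "x \<in> supported" "conj_act g N = normal_form x"
    and charpoly: "\<And>z. det (mat z - complexify N) = det (mat z - complexify (normal_form x))"
    using normal_form_exists[OF assms] by metis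
  obtain w where "w \<in> weyl" "skew_eigenvalues e N = w x"
    using charpoly_eq_imp_weyl[OF x(1) skew_eigenvalues(1)[OF assms]] charpoly skew_eigenvalues(2)[OF assms]
    by metis
  then obtain g' where g': "orthogonal_matrix g'" "conj_act g' (normal_form x) = normal_form (skew_eigenvalues e N)"
    using weyl_realised_by_conj_act by metis
  define r where "r = g' ** g"
  have r: "orthogonal_matrix r" "conj_act r N = normal_form (skew_eigenvalues e N)"
    using g g' x(2) by (simp_all add: r_def orthogonal_matrix_mul flip: conj_act_mult)
  have "{conj_act h N | h. orthogonal_matrix h} = orbit (skew_eigenvalues e N)"
  proof (intro equalityI subsetI)
    fix X assume "X \<in> {conj_act h N | h. orthogonal_matrix h}"
    then obtain h where h: "orthogonal_matrix h" "X = conj_act h N" by blast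
    have "X = conj_act (h ** transpose r) (normal_form (skew_eigenvalues e N))"
      unfolding h(2) r(2)[symmetric] conj_act_mult[symmetric] using r(1) by simp
    then show "X \<in> orbit (skew_eigenvalues e N)"
      using h(1) r(1) unfolding orbit_def
      by (metis (mono_tags, lifting) mem_Collect_eq orthogonal_matrix_mul orthogonal_matrix_transpose)
  next
    fix X assume "X \<in> orbit (skew_eigenvalues e N)"
    then obtain h where "orthogonal_matrix h" "X = conj_act (h ** r) N"
      unfolding orbit_def r(2)[symmetric] by (auto simp: conj_act_mult)
    then show "X \<in> {conj_act h N | h. orthogonal_matrix h}"
      using r(1) by (auto intro: orthogonal_matrix_mul)
  qed
  then show ?thesis
    by (simp add: orbitope_def)
qed

lemma B_orbit_weyl_image:
  assumes "P \<subseteq> supported" "w \<in> weyl"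
  shows "B_orbit e (w ` P) = B_orbit e P"
proof -
  obtain v where v: "v \<in> weyl" "v \<circ> w = id"
    using weyl_inverse[OF assms(2)] by metis
  have "w ` P \<subseteq> supported"
    using assms weyl_supported by blast
  moreover have "(\<lambda>u. u ` w ` P) ` weyl = (\<lambda>u. u ` P) ` weyl"
  proof (intro equalityI subsetI; elim imageE; hypsubst)
    show "u ` w ` P \<in> (\<lambda>u. u ` P) ` weyl" if "u \<in> weyl" for u
      using weyl_comp[OF that assms(2)] by (metis image_comp image_eqI)
    show "u ` P \<in> (\<lambda>u. u ` w ` P) ` weyl" if "u \<in> weyl" for u
    proof -
      have "u ` P = (u \<circ> v) ` w ` P"
        by (metis comp_assoc comp_id image_comp v(2))
      then show ?thesis
        using weyl_comp[OF that v(1)] by blast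
    qed
  qed
  ultimately show ?thesis
    using assms(1) by (simp add: B_orbit_eq)
qed

end

theorem theorem3p11:
  fixes N :: "real^'n^'n" and e :: "nat \<Rightarrow> 'n::finite" and F :: "(real^'n^'n) set"
  assumes e: "bij_betw e {1..CARD('n)} UNIV"
    and skew: "skew_symmetric N"
    and face: "closed_face F (orbitope N)"
    and nonempty: "F \<noteq> {}"
  shows "(\<exists>P. closed_face P (B_permutahedron e (skew_eigenvalues e N)) \<and>
              SD e -` P \<inter> orbitope N \<in> O_orbit F) \<and>
         (\<forall>P Q. closed_face P (B_permutahedron e (skew_eigenvalues e N)) \<and>
                SD e -` P \<inter> orbitope N \<in> O_orbit F \<and>
                closed_face Q (B_permutahedron e (skew_eigenvalues e N)) \<and>
                SD e -` Q \<inter> orbitope N \<in> O_orbit F \<longrightarrow>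
                B_orbit e P = B_orbit e Q)"
proof -
  interpret enumeration e "half_dim TYPE('n)"
    by unfold_locales (use e in simp_all)
  define p where "p = skew_eigenvalues e N"
  have p: "p \<in> supported"
    unfolding p_def using skew by (rule skew_eigenvalues(1))
  have hull: "orbitope N = convex hull (orbit p)"
    unfolding p_def using skew by (rule orbitope_eq)
  have closed_face: "closed_face P (B_permutahedron e p) \<longleftrightarrow> P face_of permutahedron p" for P
    using polytope_permutahedron polytope_imp_convex polytope_imp_closed face_of_imp_closed
    unfolding closed_face_def B_permutahedron_eq[OF p] by blast
  have pullback: "SD e -` P \<inter> orbitope N = pullback p P" for P
    by (auto simp: pullback_def hull SD_eq_skew_diag)
  have F: "F face_of convex hull (orbit p)"
    using face by (simp add: closed_face_def hull)
  obtain g P where "orthogonal_matrix g" "P face_of permutahedron p" "conj_act g ` F = pullback p P"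
    using face_orbit_contains_pullback[OF p F nonempty] by metis
  then have "\<exists>P. P face_of permutahedron p \<and> pullback p P \<in> O_orbit F"
    unfolding O_orbit_def by fastforce
  moreover have "B_orbit e P = B_orbit e Q"
    if P: "P face_of permutahedron p" "pullback p P \<in> O_orbit F"
      and Q: "Q face_of permutahedron p" "pullback p Q \<in> O_orbit F" for P Q
  proof -
    obtain g h where g: "orthogonal_matrix g" "pullback p P = conj_act g ` F"
      and h: "orthogonal_matrix h" "pullback p Q = conj_act h ` F"
      using P(2) Q(2) by (auto simp: O_orbit_def)
    have "P \<noteq> {}"
      using g(2) nonempty by (auto simp: pullback_def)
    have "conj_act (h ** transpose g) ` pullback p P = pullback p Q"
      unfolding g(2) h(2) image_image using g(1) by (simp flip: conj_act_mult)
    then obtain w where "w \<in> weyl" "Q = w ` P"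
      using pullback_conj_weyl[OF p P(1) \<open>P \<noteq> {}\<close> Q(1)] g(1) h(1)
      by (metis orthogonal_matrix_mul orthogonal_matrix_transpose)
    moreover have "P \<subseteq> supported"
      using face_of_imp_subset[OF P(1)] permutahedron_supported[OF p] by blast
    ultimately show ?thesis
      by (simp add: B_orbit_weyl_image)
  qed
  ultimately show ?thesis
    unfolding p_def[symmetric] closed_face pullback by blast
qed

end
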